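(* Let $V$ and $Y$ be real-valued $\Gamma$-periodic functions on $\mathbb{Z}^d$. Suppose that there exist $\lambda_1,\lambda_2\in\mathbb{C}$ and a set $S\subset\{1,2,\dots,d\}$ with $\#S\ge 3$ such that $V$ and $Y$ are generalized partially Fermi isospectral with respect to $(S,\lambda_1,\lambda_2)$. Then for any $s,t\in S$ with $s<t$: if $V$ is $(s,t)$-separable, then $Y$ is also $(s,t)$-separable.
   Context: Let $q_1,\dots,q_d$ be pairwise coprime positive integers, $\Gamma=q_1\mathbb{Z}\oplus\cdots\oplus q_d\mathbb{Z}$, $Q=q_1q_2\cdots q_d$. A function $V:\mathbb{Z}^d\to\mathbb{C}$ is $\Gamma$-periodic if $V(n+\gamma)=V(n)$ for all $n\in\mathbb{Z}^d$, $\gamma\in\Gamma$. The discrete Laplacian is $(\Delta u)(n)=\sum_{\|n'-n\|=1}u(n')$ with $\|n'-n\|=\sum_{l=1}^d|n_l-n'_l|$. For $k=(k_1,\dots,k_d)$, the functions $u:\mathbb{Z}^d\to\mathbb{C}$ satisfying the Floquet-Bloch condition $u(n+q_j\mathbf{e}_j)=e^{2\pi \mathrm{i}k_j}u(n)$ for all $n\in\mathbb{Z}^d$, $j=1,\dots,d$ ($\mathbf{e}_j$ the standard basis) form a $Q$-dimensional space, each such $u$ being determined by its values on $W=\{n\in\mathbb{Z}^d:0\le n_j\le q_j-1,\ j=1,\dots,d\}$. For $\Gamma$-periodic $V$ the operator $\Delta+V$ preserves this space, and $D_V(k)$ denotes the $Q\times Q$ matrix of its restriction in the coordinates $(u(n))_{n\in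 W}$. Put $P_V(k,\lambda)=\det(D_V(k)-\lambda I)$. Generalized partial Fermi isospectrality ($d\ge2$): for a non-empty set $S\subset\{1,\dots,d\}$ and $\lambda_1,\lambda_2\in\mathbb{C}$, two $\Gamma$-periodic functions $V$ and $Y$ are generalized partially Fermi isospectral with respect to $(S,\lambda_1,\lambda_2)$ if there exist $k_j^*\in\mathbb{R}$ for each $j\in\{1,\dots,d\}\setminus S$ such that for all choices of $k_j\in\mathbb{R}$, $j\in S$, one has $P_V(k,\lambda_1)=P_Y(k,\lambda_2)$, where $k=(k_1,\dots,k_d)$ with $k_j=k_j^*$ for $j\notin S$. $(s,t)$-separability ($1\le s<t\le d$): a function $V$ on $\mathbb{Z}^d$ is $(s,t)$-separable if there exist functions $V_s,V_t:\mathbb{Z}^{d-1}\to\mathbb{C}$ such that for all $n\in\mathbb{Z}^d$, $V(n)=V_s(n_1,\dots,n_{t-1},n_{t+1},\dots,n_d)+V_t(n_1,\dots,n_{s-1},n_{s+1},\dots,n_d)$. *)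

theory Defs
  imports Complex_Main "HOL-Library.FuncSet" "HOL-Library.Cardinality" "Jordan_Normal_Form.Determinant"
begin

text \<open>
  The coordinates \<open>1, \<dots>, d\<close> are the elements of a finite linearly ordered index type \<open>'d\<close>
  (so \<open>d = CARD('d)\<close>), and \<open>\<int>\<^sup>d\<close> is the type \<^typ>\<open>'d \<Rightarrow> int\<close>.
\<close>

definition period_lattice :: "('d \<Rightarrow> nat) \<Rightarrow> ('d \<Rightarrow> int) set" where
  "period_lattice q = {\<gamma>. \<forall>j. int (q j) dvd \<gamma> j}"

definition lattice_periodic :: "('d \<Rightarrow> nat) \<Rightarrow> (('d \<Rightarrow> int) \<Rightarrow> complex) \<Rightarrow> bool" where
  "lattice_periodic q V \<longleftrightarrow> (\<forall>n. \<forall>\<gamma>\<in>period_lattice q. V (\<lambda>j. n j + \<gamma> j) = V n)"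

definition discrete_laplacian ::
  "(('d::finite \<Rightarrow> int) \<Rightarrow> complex) \<Rightarrow> ('d \<Rightarrow> int) \<Rightarrow> complex" where
  "discrete_laplacian u n = (\<Sum>n' | (\<Sum>l\<in>UNIV. \<bar>n l - n' l\<bar>) = 1. u n')"

definition schroedinger_op ::
  "(('d::finite \<Rightarrow> int) \<Rightarrow> complex) \<Rightarrow> (('d \<Rightarrow> int) \<Rightarrow> complex) \<Rightarrow> ('d \<Rightarrow> int) \<Rightarrow> complex" where
  "schroedinger_op V u n = discrete_laplacian u n + V n * u n"

definition floquet_bloch ::
  "('d \<Rightarrow> nat) \<Rightarrow> ('d \<Rightarrow> real) \<Rightarrow> (('d \<Rightarrow> int) \<Rightarrow> complex) \<Rightarrow> bool" where
  "floquet_bloch q k u \<longleftrightarrow>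
     (\<forall>n j. u (n(j := n j + int (q j))) = exp (2 * of_real pi * \<i> * of_real (k j)) * u n)"

definition fundamental_cell :: "('d \<Rightarrow> nat) \<Rightarrow> ('d \<Rightarrow> int) set" where
  "fundamental_cell q = {n. \<forall>j. 0 \<le> n j \<and> n j \<le> int (q j) - 1}"

definition cell_size :: "('d::finite \<Rightarrow> nat) \<Rightarrow> nat" where
  "cell_size q = (\<Prod>j\<in>UNIV. q j)"

text \<open>
  The function satisfying the Floquet-Bloch condition with prescribed values \<open>f\<close> on the
  fundamental cell; existence and uniqueness are \<open>floquet_bloch_bloch_extension\<close>,
  \<open>bloch_extension_on_cell\<close> and \<open>bloch_extension_unique\<close> below.
\<close>

definition bloch_extension ::
  "('d::finite \<Rightarrow> nat) \<Rightarrow> ('d \<Rightarrow> real) \<Rightarrow> (('d \<Rightarrow> int) \<Rightarrow> complex) \<Rightarrow> ('d \<Rightarrow> int) \<Rightarrow> complex" where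
  "bloch_extension q k f n =
     exp (2 * of_real pi * \<i> * (\<Sum>j\<in>UNIV. of_real (k j) * of_int (n j div int (q j))))
       * f (\<lambda>j. n j mod int (q j))"

text \<open>
  Library matrices are indexed by \<open>{..<Q}\<close>, so the cell is enumerated by an arbitrarily chosen
  bijection. A different choice conjugates the matrix below by a permutation matrix and leaves
  its determinant unchanged.
\<close>

definition cell_enum :: "('d::finite \<Rightarrow> nat) \<Rightarrow> nat \<Rightarrow> 'd \<Rightarrow> int" where
  "cell_enum q = (SOME w. bij_betw w {..<cell_size q} (fundamental_cell q))"

text \<open>
  Column \<open>j\<close> holds the cell values of the image of the basis function that is \<open>1\<close> at the
  \<open>j\<close>-th cell point and \<open>0\<close> at the others; see \<open>floquet_matrix_represents\<close>.
\<close>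

definition floquet_matrix ::
  "('d::finite \<Rightarrow> nat) \<Rightarrow> (('d \<Rightarrow> int) \<Rightarrow> complex) \<Rightarrow> ('d \<Rightarrow> real) \<Rightarrow> complex mat" where
  "floquet_matrix q V k = mat (cell_size q) (cell_size q)
     (\<lambda>(i, j). schroedinger_op V
        (bloch_extension q k (\<lambda>m. if m = cell_enum q j then 1 else 0)) (cell_enum q i))"

definition floquet_charpoly ::
  "('d::finite \<Rightarrow> nat) \<Rightarrow> (('d \<Rightarrow> int) \<Rightarrow> complex) \<Rightarrow> ('d \<Rightarrow> real) \<Rightarrow> complex \<Rightarrow> complex" where
  "floquet_charpoly q V k z = det (floquet_matrix q V k - z \<cdot>\<^sub>m 1\<^sub>m (cell_size q))"

definition gen_partial_fermi_isospectral ::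
  "('d::finite \<Rightarrow> nat) \<Rightarrow> 'd set \<Rightarrow> complex \<Rightarrow> complex \<Rightarrow>
   (('d \<Rightarrow> int) \<Rightarrow> complex) \<Rightarrow> (('d \<Rightarrow> int) \<Rightarrow> complex) \<Rightarrow> bool" where
  "gen_partial_fermi_isospectral q S lam1 lam2 V Y \<longleftrightarrow>
     S \<noteq> {} \<and>
     (\<exists>kstar. \<forall>k. (\<forall>j. j \<notin> S \<longrightarrow> k j = kstar j) \<longrightarrow>
        floquet_charpoly q V k lam1 = floquet_charpoly q Y k lam2)"

text \<open>
  The tuple \<open>(n\<^sub>1, \<dots>, n\<^bsub>t-1\<^esub>, n\<^bsub>t+1\<^esub>, \<dots>, n\<^sub>d)\<close> as a list of length \<open>d - 1\<close>.
\<close>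

definition omit_coord :: "'d::{finite,linorder} \<Rightarrow> ('d \<Rightarrow> int) \<Rightarrow> int list" where
  "omit_coord t n = map n (sorted_list_of_set (UNIV - {t}))"

definition separable ::
  "'d::{finite,linorder} \<Rightarrow> 'd \<Rightarrow> (('d \<Rightarrow> int) \<Rightarrow> complex) \<Rightarrow> bool" where
  "separable s t V \<longleftrightarrow>
     (\<exists>Vs Vt. \<forall>n. V n = Vs (omit_coord t n) + Vt (omit_coord s n))"

lemma length_omit_coord: "length (omit_coord t (n :: 'd::{finite,linorder} \<Rightarrow> int)) = CARD('d) - 1"
  by (simp add: omit_coord_def card_Diff_singleton)

lemma finite_neighbours:
  fixes n :: "'d::finite \<Rightarrow> int"
  shows "finite {n'. (\<Sum>l\<in>UNIV. \<bar>n l - n' l\<bar>) = 1}"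
proof (rule finite_subset)
  show "{n'. (\<Sum>l\<in>UNIV. \<bar>n l - n' l\<bar>) = 1} \<subseteq> PiE UNIV (\<lambda>l. {n l - 1..n l + 1})"
  proof
    fix n' assume "n' \<in> {n'. (\<Sum>l\<in>UNIV. \<bar>n l - n' l\<bar>) = 1}"
    hence a: "(\<Sum>l\<in>UNIV. \<bar>n l - n' l\<bar>) = 1" by simp
    have "n' l \<in> {n l - 1..n l + 1}" for l
    proof -
      have "\<bar>n l - n' l\<bar> \<le> (\<Sum>l\<in>UNIV. \<bar>n l - n' l\<bar>)"
        by (rule member_le_sum) simp_all
      hence "\<bar>n l - n' l\<bar> \<le> 1" by (simp only: a)
      thus ?thesis by (simp add: abs_le_iff)
    qed
    thus "n' \<in> PiE UNIV (\<lambda>l. {n l - 1..n l + 1})" by (intro PiE_I) simp_all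
  qed
  show "finite (PiE UNIV (\<lambda>l. {n l - 1..n l + 1}))"
    by (intro finite_PiE) simp_all
qed

lemma fundamental_cell_eq_PiE:
  "fundamental_cell q = PiE UNIV (\<lambda>j. {0..<int (q j)})"
  by (simp add: fundamental_cell_def PiE_UNIV_domain Pi_def)

lemma finite_fundamental_cell: "finite (fundamental_cell (q :: 'd::finite \<Rightarrow> nat))"
  unfolding fundamental_cell_eq_PiE by (intro finite_PiE) auto

lemma card_fundamental_cell: "card (fundamental_cell (q :: 'd::finite \<Rightarrow> nat)) = cell_size q"
  unfolding fundamental_cell_eq_PiE cell_size_def by (subst card_PiE) auto

lemma bij_betw_cell_enum: "bij_betw (cell_enum q) {..<cell_size q} (fundamental_cell q)"
proof -
  have "\<exists>w. bij_betw w {..<cell_size q} (fundamental_cell q)"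
    using ex_bij_betw_nat_finite[OF finite_fundamental_cell[of q]]
    by (simp add: card_fundamental_cell atLeast0LessThan)
  thus ?thesis unfolding cell_enum_def by (rule someI_ex)
qed

lemma floquet_bloch_bloch_extension:
  assumes "\<forall>j. 0 < q j"
  shows "floquet_bloch q k (bloch_extension q k f)"
  unfolding floquet_bloch_def
proof (intro allI)
  fix n :: "'a \<Rightarrow> int" and j :: 'a
  let ?n' = "n(j := n j + int (q j))"
  have q: "int (q j) \<noteq> 0" using assms by (metis of_nat_0_eq_iff less_irrefl)
  have m: "(\<lambda>l. ?n' l mod int (q l)) = (\<lambda>l. n l mod int (q l))"
    by (auto simp: fun_eq_iff)
  let ?g = "\<lambda>n l. complex_of_real (k l) * of_int (n l div int (q l))"
  have "(\<Sum>l\<in>UNIV. ?g ?n' l) = ?g ?n' j + (\<Sum>l\<in>UNIV - {j}. ?g ?n' l)"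
    by (rule sum.remove) auto
  also have "(\<Sum>l\<in>UNIV - {j}. ?g ?n' l) = (\<Sum>l\<in>UNIV - {j}. ?g n l)"
    by (rule sum.cong) auto
  also have "?g ?n' j = of_real (k j) + ?g n j"
    using q by (simp add: algebra_simps)
  also have "of_real (k j) + ?g n j + (\<Sum>l\<in>UNIV - {j}. ?g n l) =
      of_real (k j) + (\<Sum>l\<in>UNIV. ?g n l)"
    by (subst sum.remove[of UNIV j "?g n"]) (auto simp: add.assoc)
  finally have s: "(\<Sum>l\<in>UNIV. ?g ?n' l) = of_real (k j) + (\<Sum>l\<in>UNIV. ?g n l)" .
  show "bloch_extension q k f ?n' =
      exp (2 * of_real pi * \<i> * of_real (k j)) * bloch_extension q k f n"
    unfolding bloch_extension_def m s by (simp only: distrib_left exp_add mult.assoc)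
qed

lemma bloch_extension_on_cell:
  assumes "n \<in> fundamental_cell q"
  shows "bloch_extension q k f n = f n"
proof -
  have "n j div int (q j) = 0" "n j mod int (q j) = n j" for j
    using assms by (auto simp: fundamental_cell_def intro!: div_pos_pos_trivial mod_pos_pos_trivial)
  thus ?thesis by (simp add: bloch_extension_def)
qed

lemma floquet_bloch_shift:
  assumes "floquet_bloch q k u"
  shows "u (n(j := n j + int (q j) * m)) = exp (2 * of_real pi * \<i> * (of_real (k j) * of_int m)) * u n"
proof (induction m rule: int_induct[where k = 0])
  case base
  show ?case by simp
next
  case (step1 m)
  let ?n = "n(j := n j + int (q j) * m)"
  have "u (n(j := n j + int (q j) * (m + 1))) = u (?n(j := ?n j + int (q j)))"
    by (simp add: algebra_simps)
  also have "\<dots> = exp (2 * of_real pi * \<i> * of_real (k j)) * u ?n"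
    using assms unfolding floquet_bloch_def by blast
  also have "\<dots> = exp (2 * of_real pi * \<i> * of_real (k j)) *
      exp (2 * of_real pi * \<i> * (of_real (k j) * of_int m)) * u n"
    by (simp only: step1.IH mult.assoc)
  finally show ?case by (simp only: of_int_add of_int_1 distrib_left mult_1_left mult_1_right exp_add mult_ac)
next
  case (step2 m)
  let ?n = "n(j := n j + int (q j) * (m - 1))"
  have "u (n(j := n j + int (q j) * m)) = u (?n(j := ?n j + int (q j)))"
    by (simp add: algebra_simps)
  also have "\<dots> = exp (2 * of_real pi * \<i> * of_real (k j)) * u ?n"
    using assms unfolding floquet_bloch_def by blast
  finally have "exp (2 * of_real pi * \<i> * (of_real (k j) * of_int m)) * u n =
      exp (2 * of_real pi * \<i> * of_real (k j)) * u ?n"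
    by (simp only: step2.IH)
  thus ?case
    by (simp only: of_int_diff of_int_1 right_diff_distrib mult_1_right exp_diff)
      (simp add: field_simps fun_upd_def)
qed

lemma bloch_extension_unique:
  assumes "floquet_bloch q k u" "\<forall>n\<in>fundamental_cell q. u n = f n" "\<forall>j. 0 < q j"
  shows "u = bloch_extension q k f"
proof
  fix n :: "'a \<Rightarrow> int"
  define r where "r F = (\<lambda>j. if j \<in> F then n j mod int (q j) else n j)" for F
  have "u n = exp (2 * of_real pi * \<i> * (\<Sum>j\<in>F. of_real (k j) * of_int (n j div int (q j)))) * u (r F)"
    if "finite F" for F using that
  proof (induction F)
    case empty
    show ?case by (simp add: r_def)
  next
    case (insert j F)
    have "r F = (r (insert j F))(j := r (insert j F) j + int (q j) * (n j div int (q j)))"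
      using insert.hyps by (auto simp: r_def fun_eq_iff)
    hence "u (r F) = exp (2 * of_real pi * \<i> * (of_real (k j) * of_int (n j div int (q j)))) * u (r (insert j F))"
      using floquet_bloch_shift[OF assms(1)] by metis
    with insert show ?case
      by (simp only: sum.insert[OF insert.hyps] distrib_left exp_add mult_ac)
  qed
  from this[of UNIV] have "u n = exp (2 * of_real pi * \<i> *
      (\<Sum>j\<in>UNIV. of_real (k j) * of_int (n j div int (q j)))) * u (r UNIV)" by simp
  moreover have "r UNIV \<in> fundamental_cell q"
    using assms(3) by (auto simp: r_def fundamental_cell_def)
  ultimately show "u n = bloch_extension q k f n"
    using assms(2) by (simp add: bloch_extension_def r_def)
qed

lemma floquet_matrix_represents:
  assumes "floquet_bloch q k u" "\<forall>j. 0 < q j" "i < cell_size q"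
  shows "schroedinger_op V u (cell_enum q i) =
    (\<Sum>j<cell_size q. floquet_matrix q V k $$ (i, j) * u (cell_enum q j))"
proof -
  let ?e = "\<lambda>j. bloch_extension q k (\<lambda>m. if m = cell_enum q j then 1 else 0)"
  have u: "u n = (\<Sum>j<cell_size q. u (cell_enum q j) * ?e j n)" for n
  proof -
    let ?r = "\<lambda>j. n j mod int (q j)"
    have "?r \<in> fundamental_cell q" using assms(2) by (auto simp: fundamental_cell_def)
    hence "?r \<in> cell_enum q ` {..<cell_size q}"
      using bij_betw_imp_surj_on[OF bij_betw_cell_enum[of q]] by simp
    then obtain l where l: "l < cell_size q" "cell_enum q l = ?r"
      by (auto simp del: mod_pos_pos_trivial)
    have "(\<Sum>j<cell_size q. u (cell_enum q j) * ?e j n) =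
        (\<Sum>j<cell_size q. if j = l then bloch_extension q k u n else 0)"
    proof (rule sum.cong)
      fix j assume "j \<in> {..<cell_size q}"
      hence "cell_enum q j = ?r \<longleftrightarrow> j = l"
        using l(1) inj_on_eq_iff[OF bij_betw_imp_inj_on[OF bij_betw_cell_enum[of q]], of j l]
        by (simp flip: l(2))
      thus "u (cell_enum q j) * ?e j n = (if j = l then bloch_extension q k u n else 0)"
        using l(2) by (auto simp: bloch_extension_def)
    qed simp
    also have "\<dots> = bloch_extension q k u n" using l by simp
    also have "\<dots> = u n"
      using bloch_extension_unique[OF assms(1) _ assms(2), of u] by simp
    finally show ?thesis by (rule sym)
  qed
  have "discrete_laplacian u n = (\<Sum>j<cell_size q. u (cell_enum q j) * discrete_laplacian (?e j) n)" for n
    unfolding discrete_laplacian_def sum_distrib_left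
    by (subst sum.swap) (rule sum.cong, simp, rule u)
  hence "schroedinger_op V u n = (\<Sum>j<cell_size q. schroedinger_op V (?e j) n * u (cell_enum q j))" for n
    unfolding schroedinger_op_def using u[of n]
    by (simp add: sum.distrib sum_distrib_left algebra_simps)
  thus ?thesis using assms(3) by (simp add: floquet_matrix_def)
qed

end

theory Submission
  imports Defs
begin

text \<open>
  A \<open>\<Gamma>\<close>-periodic function is \<open>(s,t)\<close>-separable exactly when its Fourier coefficients
  at all \<open>l\<close> with \<open>l\<^sub>s \<noteq> 0 \<noteq> l\<^sub>t\<close> vanish
  (\<open>separable_imp_fourier_coeff_eq_0\<close>, \<open>separable_if_fourier_coeff_eq_0\<close>). Fermi isospectrality has
  to carry this vanishing from \<open>V\<close> to \<open>Y\<close>.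

  In the basis of Bloch waves the Laplacian is diagonal and the potential is a convolution: with
  \<open>z\<^sub>j = e\<^bsup>2\<pi>ik\<^sub>j/q\<^sub>j\<^esup>\<close> the matrix has the entries
  \<open>\<delta>\<^sub>m\<^sub>n (\<Sum>\<^sub>j \<rho>\<^sub>j z\<^sub>j + 1/(\<rho>\<^sub>j z\<^sub>j)) + V\<^sup>^(m - n)\<close>, where
  \<open>V\<^sup>^\<close> denotes the Fourier coefficients and \<open>\<rho>\<^sub>j\<close> is the root of unity \<open>e\<^bsup>2\<pi>in\<^sub>j/q\<^sub>j\<^esup>\<close>
  (\<open>floquet_charpoly_eq_det_fourier_matrix\<close>). Its determinant is a Laurent polynomial in each \<open>z\<^sub>j\<close>.
  Choose \<open>r \<in> S\<close> other than \<open>s\<close> and \<open>t\<close> and keep all variables but \<open>z\<^sub>s, z\<^sub>t, z\<^sub>r\<close> fixed; the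
  equality of the two determinants then extends from the unit torus to all non-zero
  \<open>z\<^sub>s, z\<^sub>t, z\<^sub>r\<close> (\<open>det_fourier_matrix_eq_on_torus\<close>).

  Now let these three variables tend to infinity in the direction \<open>v\<close>, that is, put
  \<open>(z\<^sub>s, z\<^sub>t, z\<^sub>r) = v/x\<close> with \<open>x \<rightarrow> 0\<close>. Multiplied by \<open>x\<close>, the matrix is a perturbation of the
  diagonal matrix with entries \<open>L\<^sub>n = \<alpha>\<^sub>n v\<^sub>1 + \<beta>\<^sub>n v\<^sub>2 + \<gamma>\<^sub>n v\<^sub>3\<close>, where the coefficients are
  \<open>q\<^sub>s\<close>-th, \<open>q\<^sub>t\<close>-th and \<open>q\<^sub>r\<close>-th roots of unity. The first order in \<open>x\<close> shows that
  \<open>V\<^sup>^(0) - \<lambda>\<^sub>1 = Y\<^sup>^(0) - \<lambda>\<^sub>2\<close>, because \<open>\<Sum> 1/L\<^sub>n\<close> is not identically zero,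
  and then the second order shows that
  \<open>\<Sum> w(m - n)/(L\<^sub>m L\<^sub>n) = 0\<close> with \<open>w = |V\<^sup>^|\<^sup>2 - |Y\<^sup>^|\<^sup>2\<close>, the sum being over
  pairs of different frequencies (\<open>det_eq_imp_expansions_eq\<close>).

  It remains to isolate one frequency \<open>l\<close> with \<open>l\<^sub>s \<noteq> 0 \<noteq> l\<^sub>t\<close>. Let \<open>p\<close> be the direction, unique up
  to scaling, in which \<open>L\<^sub>0\<close> and \<open>L\<^sub>l\<close> vanish. If \<open>L\<^sub>n\<close> vanishes at \<open>p\<close> then
  \<open>\<alpha>\<^sub>n p\<^sub>1, \<beta>\<^sub>n p\<^sub>2, \<gamma>\<^sub>n p\<^sub>3\<close> are the sides of a triangle of given side lengths. Such a triangle is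
  unique up to rotation and reflection, so the coefficients of \<open>L\<^sub>n\<close> are those of \<open>L\<^sub>0\<close> or \<open>L\<^sub>l\<close> up to
  a common factor (\<open>unit_triangle_rigidity\<close>), and coprimality forces this factor to be \<open>1\<close>. So only
  terms with \<open>m\<close> and \<open>n\<close> in these two classes survive when \<open>v\<close> tends to \<open>p\<close>. Approaching \<open>p\<close> along a
  line on which \<open>L\<^sub>0\<close> has derivative \<open>1\<close> and \<open>L\<^sub>l\<close> has derivative \<open>\<i>\<close>, pairs inside a class give real
  limits and mixed pairs give imaginary ones. Since \<open>w\<close> is real, the sum of \<open>w\<close> over the mixed pairs
  is zero. On them \<open>V\<^sup>^\<close> is zero because \<open>V\<close> is separable, so \<open>w = -|Y\<^sup>^|\<^sup>2 \<le> 0\<close>;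
  hence every \<open>Y\<^sup>^\<close> occurring there is zero, in particular \<open>Y\<^sup>^(l)\<close>
  (\<open>fourier_coeff_eq_0_transfer\<close>).
\<close>

section \<open>Roots of unity and characters of the lattice\<close>

definition unity_root :: "nat \<Rightarrow> int \<Rightarrow> complex" where
  "unity_root p m = cis (2 * pi * real_of_int m / real p)"

lemma unity_root_0 [simp]: "unity_root p 0 = 1"
  by (simp add: unity_root_def)

lemma unity_root_nonzero [simp]: "unity_root p m \<noteq> 0"
  by (simp add: unity_root_def)

lemma norm_unity_root [simp]: "norm (unity_root p m) = 1"
  by (simp add: unity_root_def)

lemma unity_root_add: "unity_root p (m + n) = unity_root p m * unity_root p n"
  by (simp add: unity_root_def cis_mult ring_distribs add_divide_distrib)

lemma unity_root_minus: "unity_root p (- m) = inverse (unity_root p m)"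
  by (simp add: unity_root_def)

lemma unity_root_diff: "unity_root p (m - n) = unity_root p m / unity_root p n"
  using unity_root_add[of p m "- n"] by (simp add: unity_root_minus divide_inverse)

lemma unity_root_eq_1_iff:
  assumes "0 < p"
  shows "unity_root p m = 1 \<longleftrightarrow> int p dvd m"
proof
  assume "unity_root p m = 1"
  hence "cos (2 * pi * real_of_int m / real p) = 1"
    by (simp add: unity_root_def complex_eq_iff)
  then obtain k :: int where "2 * pi * real_of_int m / real p = of_int k * 2 * pi"
    by (auto simp: cos_one_2pi_int)
  hence "real_of_int m = real_of_int (k * int p)"
    using assms by (simp add: field_simps)
  thus "int p dvd m" by (simp only: of_int_eq_iff) simp
next
  assume "int p dvd m"
  then obtain k where "m = int p * k" ..
  thus "unity_root p m = 1"
    using assms cis_multiple_2pi[of "of_int k"] by (simp add: unity_root_def mult.assoc)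
qed

lemma unity_root_power_period:
  assumes "0 < p"
  shows "unity_root p m ^ p = 1"
  using assms cis_multiple_2pi[of "of_int m"] by (simp add: unity_root_def DeMoivre)

lemma unity_root_mult_mod:
  assumes "0 < p"
  shows "unity_root p (l * (n mod int p)) = unity_root p (l * n)"
proof -
  have "l * n = l * (n mod int p) + int p * (l * (n div int p))"
    using mult_div_mod_eq[of "int p" n] by (metis (no_types) distrib_left mult.left_commute add.commute)
  moreover have "unity_root p (int p * (l * (n div int p))) = 1"
    using assms by (simp add: unity_root_eq_1_iff)
  ultimately show ?thesis by (simp add: unity_root_add)
qed

lemma eq_1_if_coprime_powers_eq_1:
  fixes x :: complex
  assumes "x ^ a = 1" "x ^ b = 1" "coprime a b" "0 < a"
  shows "x = 1"
proof -
  have "x \<noteq> 0" using assms by (auto simp: power_0_left)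
  obtain u v where "a * u = b * v + 1"
    using coprime_bezout_strong[of a b] bezout_nat[of a b] assms by (auto simp: coprime_iff_gcd_eq_1)
  hence "x ^ (a * u) = x ^ (b * v) * x" by simp
  thus ?thesis using assms by (simp add: power_mult)
qed

definition lattice_char :: "('d::finite \<Rightarrow> nat) \<Rightarrow> ('d \<Rightarrow> int) \<Rightarrow> ('d \<Rightarrow> int) \<Rightarrow> complex" where
  "lattice_char q l n = (\<Prod>j\<in>UNIV. unity_root (q j) (l j * n j))"

lemma lattice_char_nonzero [simp]: "lattice_char q l n \<noteq> 0"
  by (simp add: lattice_char_def)

lemma norm_lattice_char [simp]: "norm (lattice_char q l n) = 1"
  by (simp add: lattice_char_def flip: prod_norm)

lemma lattice_char_commute: "lattice_char q l n = lattice_char q n l"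
  by (simp add: lattice_char_def mult.commute)

lemma lattice_char_diff_left:
  "lattice_char q (\<lambda>j. l j - m j) n = lattice_char q l n / lattice_char q m n"
  by (simp add: lattice_char_def left_diff_distrib unity_root_diff prod_dividef)

lemma lattice_char_minus_left: "lattice_char q (\<lambda>j. - l j) n = inverse (lattice_char q l n)"
  using lattice_char_diff_left[of q "\<lambda>_. 0" l n] by (simp add: lattice_char_def divide_inverse)

lemma cnj_lattice_char: "cnj (lattice_char q l n) = inverse (lattice_char q l n)"
  by (rule inverse_unique[symmetric]) (simp flip: complex_norm_square)

lemma lattice_char_upd:
  "lattice_char q l (n(t := n t + c)) = unity_root (q t) (l t * c) * lattice_char q l n"
proof -
  have "lattice_char q l (n(t := n t + c)) =
      unity_root (q t) (l t * (n t + c)) * (\<Prod>j\<in>UNIV - {t}. unity_root (q j) (l j * n j))"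
    unfolding lattice_char_def by (subst prod.remove[of UNIV t]) auto
  also have "\<dots> = unity_root (q t) (l t * c) *
      (unity_root (q t) (l t * n t) * (\<Prod>j\<in>UNIV - {t}. unity_root (q j) (l j * n j)))"
    by (simp add: ring_distribs unity_root_add mult_ac)
  also have "unity_root (q t) (l t * n t) * (\<Prod>j\<in>UNIV - {t}. unity_root (q j) (l j * n j)) = lattice_char q l n"
    unfolding lattice_char_def by (rule prod.remove[symmetric]) auto
  finally show ?thesis .
qed

lemma lattice_char_mod:
  assumes "\<forall>j. 0 < q j"
  shows "lattice_char q l (\<lambda>j. n j mod int (q j)) = lattice_char q l n"
  using assms by (simp add: lattice_char_def unity_root_mult_mod)

lemma lattice_char_upd_mod:
  assumes "\<forall>j. 0 < q j"
  shows "lattice_char q l (n(t := (n t + c) mod int (q t))) = unity_root (q t) (l t * c) * lattice_char q l n"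
proof -
  have "lattice_char q l (n(t := (n t + c) mod int (q t))) = lattice_char q l (n(t := n t + c))"
    using assms by (subst (1 2) lattice_char_mod[OF assms, symmetric])
      (auto intro!: arg_cong[where f = "lattice_char q l"])
  thus ?thesis by (simp add: lattice_char_upd)
qed

text \<open>
  Translating by one unit in the direction \<open>t\<close>, cyclically inside the cell, multiplies the sum by a
  root of unity different from \<open>1\<close> and at the same time leaves it unchanged. With \<open>f = 1\<close> this is
  the orthogonality of characters, with \<open>f\<close> independent of the coordinate \<open>t\<close> it gives the vanishing
  Fourier coefficients of separable functions.
\<close>

lemma sum_char_invariant_eq_0:
  assumes q: "\<forall>j. 0 < q j"
    and ne: "unity_root (q t) (l t) \<noteq> 1"
    and inv: "\<And>n x. f (n(t := x)) = f n"
  shows "(\<Sum>n\<in>fundamental_cell q. f n * lattice_char q l n) = 0"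
proof -
  let ?C = "fundamental_cell q"
  let ?S = "\<Sum>n\<in>?C. f n * lattice_char q l n"
  have pos: "0 < int (q t)" using q by simp
  have b: "0 \<le> n t \<and> n t < int (q t)" if "n \<in> ?C" for n
    using that by (force simp: fundamental_cell_def dest: spec[of _ t])
  have cell: "n(t := y mod int (q t)) \<in> ?C" if "n \<in> ?C" for n y
    using that pos by (auto simp: fundamental_cell_def)
  have "?S = (\<Sum>n\<in>?C. f (n(t := (n t + 1) mod int (q t))) * lattice_char q l (n(t := (n t + 1) mod int (q t))))"
    by (rule sum.reindex_bij_witness[where i = "\<lambda>n. n(t := (n t + 1) mod int (q t))"
          and j = "\<lambda>n. n(t := (n t - 1) mod int (q t))"])
      (use b cell in \<open>auto simp: mod_simps fun_upd_idem_iff\<close>)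
  also have "\<dots> = unity_root (q t) (l t) * ?S"
    by (simp add: lattice_char_upd_mod[OF q] inv sum_distrib_left mult_ac)
  finally have "(unity_root (q t) (l t) - 1) * ?S = 0" by (simp add: left_diff_distrib)
  thus ?thesis using ne by simp
qed

lemma sum_lattice_char:
  assumes q: "\<forall>j. 0 < q j"
  shows "(\<Sum>n\<in>fundamental_cell q. lattice_char q l n) =
    (if \<forall>j. int (q j) dvd l j then of_nat (cell_size q) else 0)"
proof (cases "\<forall>j. int (q j) dvd l j")
  case True
  hence "lattice_char q l n = 1" for n
    unfolding lattice_char_def using q by (intro prod.neutral) (simp add: unity_root_eq_1_iff)
  thus ?thesis using True by (simp add: card_fundamental_cell)
next
  case False
  then obtain t where "unity_root (q t) (l t) \<noteq> 1" using q by (auto simp: unity_root_eq_1_iff)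
  from sum_char_invariant_eq_0[where t = t and f = "\<lambda>_. 1" and l = l, OF q this] False show ?thesis by (auto split: if_splits)
qed

lemma cell_eq_iff_dvd:
  assumes "m \<in> fundamental_cell q" "n \<in> fundamental_cell q"
  shows "(\<forall>j. int (q j) dvd m j - n j) \<longleftrightarrow> m = n"
proof
  assume *: "\<forall>j. int (q j) dvd m j - n j"
  show "m = n"
  proof
    fix j
    have "m j mod int (q j) = n j mod int (q j)" using * by (simp add: mod_eq_dvd_iff)
    moreover have "0 \<le> m j \<and> m j < int (q j)" "0 \<le> n j \<and> n j < int (q j)"
      using assms by (auto simp: fundamental_cell_def dest!: spec[of _ j])
    ultimately show "m j = n j" by simp
  qed
qed simp

lemma sum_lattice_char_diff:
  assumes q: "\<forall>j. 0 < q j" and "m \<in> fundamental_cell q" "n \<in> fundamental_cell q"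
  shows "(\<Sum>x\<in>fundamental_cell q. lattice_char q m x / lattice_char q n x) =
    (if m = n then of_nat (cell_size q) else 0)"
  using sum_lattice_char[OF q, of "\<lambda>j. m j - n j"] cell_eq_iff_dvd[OF assms(2,3)]
  by (simp add: lattice_char_diff_left)

lemma cell_size_pos: "\<forall>j. 0 < q j \<Longrightarrow> 0 < cell_size q"
  by (simp add: cell_size_def)

section \<open>Fourier coefficients\<close>

definition fourier_coeff ::
  "('d::finite \<Rightarrow> nat) \<Rightarrow> (('d \<Rightarrow> int) \<Rightarrow> complex) \<Rightarrow> ('d \<Rightarrow> int) \<Rightarrow> complex" where
  "fourier_coeff q V l = (\<Sum>n\<in>fundamental_cell q. V n / lattice_char q l n) / of_nat (cell_size q)"

text \<open>
  Multiplication by \<open>V\<close> acts on the character of frequency \<open>m\<close> as convolution by the Fourier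
  coefficients. The differences of frequencies leave the cell, but characters depend on them only
  modulo \<open>q\<close>, so the sum may run over any set of representatives. The case \<open>m = 0\<close> is the inversion
  formula.
\<close>

lemma fourier_inversion_shifted:
  assumes q: "\<forall>j. 0 < q j" and n: "n \<in> fundamental_cell q"
  shows "(\<Sum>m'\<in>fundamental_cell q. fourier_coeff q V (\<lambda>j. m' j - m j) * lattice_char q m' n) =
    V n * lattice_char q m n"
proof -
  let ?C = "fundamental_cell q" and ?Q = "of_nat (cell_size q) :: complex"
  have "(\<Sum>m'\<in>?C. fourier_coeff q V (\<lambda>j. m' j - m j) * lattice_char q m' n) =
      (\<Sum>m'\<in>?C. \<Sum>x\<in>?C. V x * lattice_char q m x / ?Q * (lattice_char q n m' / lattice_char q x m'))"
    unfolding fourier_coeff_def sum_divide_distrib sum_distrib_right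
    by (intro sum.cong refl) (simp add: lattice_char_diff_left lattice_char_commute[of q n]
        lattice_char_commute[of q x for x] field_simps)
  also have "\<dots> = (\<Sum>x\<in>?C. V x * lattice_char q m x / ?Q *
      (\<Sum>m'\<in>?C. lattice_char q n m' / lattice_char q x m'))"
    by (subst sum.swap) (simp add: sum_distrib_left)
  also have "\<dots> = (\<Sum>x\<in>?C. if x = n then V n * lattice_char q m n else 0)"
    by (rule sum.cong) (use q n cell_size_pos[OF q] in \<open>auto simp: sum_lattice_char_diff\<close>)
  also have "\<dots> = V n * lattice_char q m n"
    using n by (simp add: finite_fundamental_cell)
  finally show ?thesis .
qed

lemma fourier_inversion:
  assumes q: "\<forall>j. 0 < q j" and V: "lattice_periodic q V"
  shows "V n = (\<Sum>l\<in>fundamental_cell q. fourier_coeff q V l * lattice_char q l n)"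
proof -
  let ?r = "\<lambda>j. n j mod int (q j)"
  have "?r \<in> fundamental_cell q" using q by (auto simp: fundamental_cell_def)
  from fourier_inversion_shifted[OF q this, of V "\<lambda>_. 0"]
  have "V ?r = (\<Sum>l\<in>fundamental_cell q. fourier_coeff q V l * lattice_char q l n)"
    by (simp add: lattice_char_mod[OF q]) (simp add: lattice_char_def)
  moreover have "V ?r = V n"
  proof -
    have "(\<lambda>j. int (q j) * (n j div int (q j))) \<in> period_lattice q"
      by (simp add: period_lattice_def)
    from bspec[OF V[unfolded lattice_periodic_def, THEN spec, of ?r] this] show ?thesis by simp
  qed
  ultimately show ?thesis by simp
qed

lemma fourier_coeff_minus_real:
  assumes "\<forall>n. V n \<in> \<real>"
  shows "fourier_coeff q V (\<lambda>j. - l j) = cnj (fourier_coeff q V l)"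
proof -
  have "cnj (V n) = V n" for n using assms by (auto simp: Reals_cnj_iff)
  thus ?thesis by (simp add: fourier_coeff_def lattice_char_minus_left cnj_lattice_char)
qed

text \<open>
  The products of opposite off-diagonal entries in the second order of the determinant are
  non-negative real numbers: this is where reality of the potentials enters.
\<close>

lemma fourier_coeff_mult_minus_real:
  assumes "\<forall>n. V n \<in> \<real>"
  shows "fourier_coeff q V (\<lambda>j. m j - n j) * fourier_coeff q V (\<lambda>j. n j - m j) =
    of_real ((cmod (fourier_coeff q V (\<lambda>j. m j - n j)))\<^sup>2)"
  using fourier_coeff_minus_real[OF assms, of q "\<lambda>j. m j - n j"]
  by (simp add: complex_norm_square del: of_real_power)

section \<open>Separability in terms of Fourier coefficients\<close>

lemma omit_coord_eq_iff:
  "omit_coord t m = omit_coord t n \<longleftrightarrow> (\<forall>j. j \<noteq> t \<longrightarrow> m j = n j)"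
  by (auto simp: omit_coord_def)

lemma omit_coord_fun_upd [simp]: "omit_coord t (n(t := x)) = omit_coord t n"
  by (simp add: omit_coord_eq_iff)

text \<open>
  In the definition of separability the summands are functions of tuples with one coordinate
  missing; this lemma turns independence of that coordinate into such a factorization.
\<close>

lemma factors_through_omit_coord:
  assumes "\<And>m n. \<forall>j. j \<noteq> t \<longrightarrow> m j = n j \<Longrightarrow> f m = f n"
  obtains g where "\<And>n. f n = g (omit_coord t n)"
proof -
  have "f n = f (SOME m. omit_coord t m = omit_coord t n)" for n
    using someI[of "\<lambda>m. omit_coord t m = omit_coord t n" n] assms
    by (metis omit_coord_eq_iff)
  thus ?thesis using that[of "\<lambda>xs. f (SOME m. omit_coord t m = xs)"] by simp
qed

lemma separable_imp_fourier_coeff_eq_0: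
  assumes q: "\<forall>j. 0 < q j" and "separable s t V"
    and "unity_root (q s) (l s) \<noteq> 1" "unity_root (q t) (l t) \<noteq> 1"
  shows "fourier_coeff q V l = 0"
proof -
  obtain f g where V: "\<And>n. V n = f (omit_coord t n) + g (omit_coord s n)"
    using assms(2) by (auto simp: separable_def)
  let ?l = "\<lambda>j. - l j"
  have "(\<Sum>n\<in>fundamental_cell q. f (omit_coord t n) * lattice_char q ?l n) = 0"
    using assms by (intro sum_char_invariant_eq_0[where t = t]) (auto simp: unity_root_minus)
  moreover have "(\<Sum>n\<in>fundamental_cell q. g (omit_coord s n) * lattice_char q ?l n) = 0"
    using assms by (intro sum_char_invariant_eq_0[where t = s]) (auto simp: unity_root_minus)
  ultimately show ?thesis
    by (simp add: fourier_coeff_def V divide_inverse lattice_char_minus_left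
        distrib_right sum.distrib)
qed

text \<open>
  Characters with \<open>l\<^sub>t = 0\<close> do not depend on the coordinate \<open>t\<close>, those with \<open>l\<^sub>s = 0\<close> not on \<open>s\<close>, and
  the Fourier expansion of \<open>V\<close> contains no others.
\<close>

lemma separable_if_fourier_coeff_eq_0:
  assumes q: "\<forall>j. 0 < q j" and V: "lattice_periodic q V"
    and 0: "\<And>l. l \<in> fundamental_cell q \<Longrightarrow> l s \<noteq> 0 \<Longrightarrow> l t \<noteq> 0 \<Longrightarrow> fourier_coeff q V l = 0"
  shows "separable s t V"
proof -
  let ?C = "fundamental_cell q"
  define f where "f = (\<lambda>n. \<Sum>l\<in>{l\<in>?C. l t = 0}. fourier_coeff q V l * lattice_char q l n)"
  define g where "g = (\<lambda>n. \<Sum>l\<in>{l\<in>?C. l t \<noteq> 0 \<and> l s = 0}. fourier_coeff q V l * lattice_char q l n)"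
  have char_cong: "lattice_char q l m = lattice_char q l n"
    if "l u = 0" "\<forall>j. j \<noteq> u \<longrightarrow> m j = n j" for l m n u
    unfolding lattice_char_def using that by (intro prod.cong) (auto, metis mult_zero_left)
  obtain f' where f': "\<And>n. f n = f' (omit_coord t n)"
    by (rule factors_through_omit_coord[of t f]) (auto simp: f_def intro!: sum.cong char_cong[of _ t])
  obtain g' where g': "\<And>n. g n = g' (omit_coord s n)"
    by (rule factors_through_omit_coord[of s g]) (auto simp: g_def intro!: sum.cong char_cong[of _ s])
  have "V n = f n + g n" for n
  proof -
    have "V n = (\<Sum>l\<in>?C. fourier_coeff q V l * lattice_char q l n)"
      by (rule fourier_inversion[OF q V])
    also have "\<dots> = (\<Sum>l\<in>{l\<in>?C. l t = 0} \<union> {l\<in>?C. l t \<noteq> 0 \<and> l s = 0}. fourier_coeff q V l * lattice_char q l n)"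
      by (rule sum.mono_neutral_right) (use 0 in \<open>auto simp: finite_fundamental_cell\<close>)
    also have "\<dots> = f n + g n"
      unfolding f_def g_def by (rule sum.union_disjoint) (auto simp: finite_fundamental_cell)
    finally show ?thesis .
  qed
  thus ?thesis unfolding separable_def using f' g' by auto
qed

section \<open>The Floquet matrix in Fourier coordinates\<close>

lemma discrete_laplacian_coordinates:
  fixes u :: "('d::finite \<Rightarrow> int) \<Rightarrow> complex"
  shows "discrete_laplacian u n = (\<Sum>j\<in>UNIV. u (n(j := n j + 1)) + u (n(j := n j + - 1)))"
proof -
  let ?h = "\<lambda>(j, c). n(j := n j + c)"
  let ?P = "(UNIV :: 'd set) \<times> {1, - 1 :: int}"
  have image: "{n'. (\<Sum>l\<in>UNIV. \<bar>n l - n' l\<bar>) = 1} = ?h ` ?P"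
  proof (rule antisym[OF subsetI subsetI])
    fix n' assume "n' \<in> {n'. (\<Sum>l\<in>UNIV. \<bar>n l - n' l\<bar>) = 1}"
    hence one: "(\<Sum>l\<in>UNIV. \<bar>n l - n' l\<bar>) = 1" by simp
    then obtain j where j: "n j \<noteq> n' j" by (metis (no_types, lifting) abs_zero diff_self sum.neutral zero_neq_one)
    have "(\<Sum>l\<in>UNIV. \<bar>n l - n' l\<bar>) = \<bar>n j - n' j\<bar> + (\<Sum>l\<in>UNIV - {j}. \<bar>n l - n' l\<bar>)"
      by (rule sum.remove) auto
    moreover have nn: "(\<Sum>l\<in>UNIV - {j}. \<bar>n l - n' l\<bar>) \<ge> 0" by (rule sum_nonneg) simp
    ultimately have "(\<Sum>l\<in>UNIV - {j}. \<bar>n l - n' l\<bar>) = 0" and abs: "\<bar>n j - n' j\<bar> = 1"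
      using one j by linarith+
    hence "n' l = n l" if "l \<noteq> j" for l
      using that sum_nonneg_eq_0_iff[of "UNIV - {j}" "\<lambda>l. \<bar>n l - n' l\<bar>"] by force
    hence "n' = n(j := n j + (n' j - n j))" by auto
    moreover have "n' j - n j \<in> {1, - 1}" using abs by auto
    ultimately have "n' = ?h (j, n' j - n j)" "(j, n' j - n j) \<in> ?P" by simp_all
    thus "n' \<in> ?h ` ?P" by blast
  next
    fix n' assume "n' \<in> ?h ` ?P"
    then obtain j c where c: "c \<in> {1, - 1 :: int}" and n': "n' = n(j := n j + c)" by auto
    have "(\<Sum>l\<in>UNIV. \<bar>n l - n' l\<bar>) = (\<Sum>l\<in>UNIV. if l = j then \<bar>c\<bar> else 0)"
      by (rule sum.cong) (auto simp: n')
    thus "n' \<in> {n'. (\<Sum>l\<in>UNIV. \<bar>n l - n' l\<bar>) = 1}" using c by auto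
  qed
  have inj: "inj_on ?h ?P"
  proof (rule inj_onI)
    fix x y assume "x \<in> ?P" "y \<in> ?P" and eq: "?h x = ?h y"
    obtain j c j' c' where [simp]: "x = (j, c)" "y = (j', c')" by (cases x, cases y)
    have c: "c \<noteq> 0" "c' \<noteq> 0" using \<open>x \<in> ?P\<close> \<open>y \<in> ?P\<close> by auto
    have "j = j'" using fun_cong[OF eq, of j] c by (auto split: if_splits)
    thus "x = y" using fun_cong[OF eq, of j] by simp
  qed
  have "discrete_laplacian u n = (\<Sum>x\<in>?P. u (?h x))"
    unfolding discrete_laplacian_def image by (simp add: sum.reindex[OF inj])
  also have "\<dots> = (\<Sum>j\<in>UNIV. \<Sum>c\<in>{1, - 1}. u (n(j := n j + c)))"
    by (subst sum.cartesian_product) (simp add: split_def)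
  finally show ?thesis by simp
qed

text \<open>
  For \<open>z\<^sub>j = e\<^bsup>2\<pi>ik\<^sub>j/q\<^sub>j\<^esup>\<close> this is the plane wave with quasimomentum \<open>k\<close> and frequency \<open>m\<close>.
\<close>

definition bloch_wave :: "('d::finite \<Rightarrow> nat) \<Rightarrow> ('d \<Rightarrow> complex) \<Rightarrow> ('d \<Rightarrow> int) \<Rightarrow> ('d \<Rightarrow> int) \<Rightarrow> complex" where
  "bloch_wave q z m n = lattice_char q m n * (\<Prod>j\<in>UNIV. z j powi n j)"

definition laplace_symbol :: "('d::finite \<Rightarrow> nat) \<Rightarrow> ('d \<Rightarrow> complex) \<Rightarrow> ('d \<Rightarrow> int) \<Rightarrow> complex" where
  "laplace_symbol q z m =
     (\<Sum>j\<in>UNIV. unity_root (q j) (m j) * z j + inverse (unity_root (q j) (m j) * z j))"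

lemma bloch_wave_upd:
  assumes "\<forall>j. z j \<noteq> 0"
  shows "bloch_wave q z m (n(t := n t + c)) = unity_root (q t) (m t * c) * z t powi c * bloch_wave q z m n"
proof -
  have "(\<Prod>j\<in>UNIV. z j powi (n(t := n t + c)) j) =
      z t powi (n t + c) * (\<Prod>j\<in>UNIV - {t}. z j powi n j)"
    by (subst prod.remove[of UNIV t]) auto
  also have "\<dots> = z t powi c * (z t powi n t * (\<Prod>j\<in>UNIV - {t}. z j powi n j))"
    using assms by (simp add: power_int_add mult_ac)
  also have "z t powi n t * (\<Prod>j\<in>UNIV - {t}. z j powi n j) = (\<Prod>j\<in>UNIV. z j powi n j)"
    by (rule prod.remove[symmetric]) auto
  finally show ?thesis by (simp add: bloch_wave_def lattice_char_upd mult_ac)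
qed

lemma discrete_laplacian_bloch_wave:
  assumes "\<forall>j. z j \<noteq> 0"
  shows "discrete_laplacian (bloch_wave q z m) n = laplace_symbol q z m * bloch_wave q z m n"
  unfolding discrete_laplacian_coordinates laplace_symbol_def bloch_wave_upd[OF assms]
  by (simp add: sum_distrib_right distrib_right power_int_minus unity_root_minus)

definition quasi_phase :: "('d \<Rightarrow> nat) \<Rightarrow> ('d \<Rightarrow> real) \<Rightarrow> 'd \<Rightarrow> complex" where
  "quasi_phase q k j = cis (2 * pi * k j / real (q j))"

lemma floquet_bloch_bloch_wave:
  assumes "\<forall>j. 0 < q j"
  shows "floquet_bloch q k (bloch_wave q (quasi_phase q k) m)"
  unfolding floquet_bloch_def
proof (intro allI)
  fix n j
  have "unity_root (q j) (m j * int (q j)) = 1" using assms by (simp add: unity_root_eq_1_iff)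
  moreover have "quasi_phase q k j powi int (q j) = exp (2 * of_real pi * \<i> * of_real (k j))"
    using assms[rule_format, of j] by (simp add: quasi_phase_def DeMoivre) (simp add: cis_conv_exp mult_ac)
  ultimately show "bloch_wave q (quasi_phase q k) m (n(j := n j + int (q j))) =
      exp (2 * of_real pi * \<i> * of_real (k j)) * bloch_wave q (quasi_phase q k) m n"
    by (subst bloch_wave_upd) (auto simp: quasi_phase_def)
qed

text \<open>
  The matrix of \<open>\<Delta> + V - \<mu>\<close> in the basis of Bloch waves. Its parameter is \<open>z\<close> instead of the
  quasimomentum because the proof leaves the torus \<open>|z\<^sub>j| = 1\<close>.
\<close>

definition fourier_matrix ::
  "('d::finite \<Rightarrow> nat) \<Rightarrow> (('d \<Rightarrow> int) \<Rightarrow> complex) \<Rightarrow> complex \<Rightarrow> ('d \<Rightarrow> complex) \<Rightarrow> complex mat" where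
  "fourier_matrix q V \<mu> z = mat (cell_size q) (cell_size q) (\<lambda>(i, j).
     fourier_coeff q V (\<lambda>x. cell_enum q i x - cell_enum q j x) +
     (if i = j then laplace_symbol q z (cell_enum q j) - \<mu> else 0))"

lemma sum_cell_enum: "(\<Sum>i<cell_size q. f (cell_enum q i)) = (\<Sum>n\<in>fundamental_cell q. f n)"
  using sum.reindex_bij_betw[OF bij_betw_cell_enum[of q], of f] by simp

lemma cell_enum_in_cell: "i < cell_size q \<Longrightarrow> cell_enum q i \<in> fundamental_cell q"
  using bij_betw_cell_enum[of q] by (auto simp: bij_betw_def)

lemma cell_enum_eq_iff:
  "i < cell_size q \<Longrightarrow> j < cell_size q \<Longrightarrow> cell_enum q i = cell_enum q j \<longleftrightarrow> i = j"
  using bij_betw_cell_enum[of q] by (auto simp: bij_betw_def inj_on_def)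

text \<open>
  The matrix \<open>U\<close> of values of the Bloch waves on the cell intertwines the Floquet matrix with the
  Fourier matrix, and it is invertible because the characters are orthogonal.
\<close>

lemma floquet_charpoly_eq_det_fourier_matrix:
  assumes q: "\<forall>j. 0 < q j"
  shows "floquet_charpoly q V k \<mu> = det (fourier_matrix q V \<mu> (quasi_phase q k))"
proof -
  define N where "N = cell_size q"
  define e where "e = cell_enum q"
  define z where "z = quasi_phase q k"
  define u where "u = bloch_wave q z"
  have z: "\<forall>j. z j \<noteq> 0" by (simp add: z_def quasi_phase_def)
  have u0: "u m n \<noteq> 0" for m n using z by (simp add: u_def bloch_wave_def)
  have Npos: "N > 0" using cell_size_pos[OF q] by (simp add: N_def)
  define F where "F = floquet_matrix q V k - \<mu> \<cdot>\<^sub>m 1\<^sub>m N"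
  define M where "M = fourier_matrix q V \<mu> z"
  define U where "U = mat N N (\<lambda>(i, j). u (e j) (e i))"
  define U' where "U' = mat N N (\<lambda>(i, j). inverse (u (e i) (e j)))"
  have F: "F \<in> carrier_mat N N"
    unfolding F_def N_def floquet_matrix_def by (intro minus_carrier_mat smult_carrier_mat one_carrier_mat)
  have dims: "F \<in> carrier_mat N N" "M \<in> carrier_mat N N" "U \<in> carrier_mat N N" "U' \<in> carrier_mat N N"
    using F by (simp_all add: M_def U_def U'_def N_def fourier_matrix_def)
  \<comment> \<open>Orthogonality of characters makes this the inverse up to the factor \<open>N\<close>.\<close>
  have "U' * U = of_nat N \<cdot>\<^sub>m 1\<^sub>m N"
  proof (rule eq_matI)
    fix i j assume "i < dim_row (of_nat N \<cdot>\<^sub>m 1\<^sub>m N :: complex mat)" "j < dim_col (of_nat N \<cdot>\<^sub>m 1\<^sub>m N :: complex mat)"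
    hence ij: "i < N" "j < N" by simp_all
    have "(U' * U) $$ (i, j) = (\<Sum>x<N. inverse (u (e i) (e x)) * u (e j) (e x))"
      using ij by (simp add: U_def U'_def scalar_prod_def atLeast0LessThan)
    also have "\<dots> = (\<Sum>x<N. lattice_char q (e j) (e x) / lattice_char q (e i) (e x))"
      using z by (simp add: u_def bloch_wave_def field_simps)
    also have "\<dots> = (\<Sum>n\<in>fundamental_cell q. lattice_char q (e j) n / lattice_char q (e i) n)"
      unfolding N_def e_def by (rule sum_cell_enum)
    also have "\<dots> = (if i = j then of_nat N else 0)"
      using ij by (subst sum_lattice_char_diff[OF q])
        (auto simp: N_def e_def cell_enum_in_cell cell_enum_eq_iff)
    finally show "(U' * U) $$ (i, j) = (of_nat N \<cdot>\<^sub>m 1\<^sub>m N) $$ (i, j)" using ij by simp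
  qed (simp_all add: U_def U'_def)
  hence "det U' * det U = of_nat N ^ N"
    using dims by (simp flip: det_mult)
  hence detU: "det U \<noteq> 0" using Npos by auto
  have "F * U = U * M"
  proof (rule eq_matI)
    fix i j assume "i < dim_row (U * M)" "j < dim_col (U * M)"
    hence ij: "i < N" "j < N" using dims by simp_all
    have "(F * U) $$ (i, j) = (\<Sum>x<N. (floquet_matrix q V k $$ (i, x) - (if i = x then \<mu> else 0)) * u (e j) (e x))"
      using ij by (simp add: F_def U_def N_def floquet_matrix_def scalar_prod_def atLeast0LessThan)
        (intro sum.cong; simp)
    also have "\<dots> = (\<Sum>x<N. floquet_matrix q V k $$ (i, x) * u (e j) (e x))
        - (\<Sum>x<N. if i = x then \<mu> * u (e j) (e x) else 0)"
      unfolding sum_subtractf[symmetric] by (rule sum.cong) (auto simp: left_diff_distrib)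
    also have "(\<Sum>x<N. floquet_matrix q V k $$ (i, x) * u (e j) (e x)) = schroedinger_op V (u (e j)) (e i)"
      using floquet_matrix_represents[OF floquet_bloch_bloch_wave[OF q, of k "e j"] q, of i V] ij
      by (simp add: N_def e_def u_def z_def)
    also have "(\<Sum>x<N. if i = x then \<mu> * u (e j) (e x) else 0) = \<mu> * u (e j) (e i)"
      using ij by simp
    finally have L: "(F * U) $$ (i, j) = (laplace_symbol q z (e j) - \<mu>) * u (e j) (e i) + V (e i) * u (e j) (e i)"
      by (simp add: schroedinger_op_def u_def discrete_laplacian_bloch_wave[OF z] algebra_simps)
    have "(U * M) $$ (i, j) = (\<Sum>x<N. u (e x) (e i) * (fourier_coeff q V (\<lambda>y. e x y - e j y)
        + (if x = j then laplace_symbol q z (e j) - \<mu> else 0)))"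
      using ij by (simp add: M_def fourier_matrix_def U_def N_def scalar_prod_def atLeast0LessThan)
        (auto simp: e_def intro!: sum.cong)
    also have "\<dots> = (\<Sum>x<N. fourier_coeff q V (\<lambda>y. e x y - e j y) * u (e x) (e i))
        + (\<Sum>x<N. if x = j then (laplace_symbol q z (e j) - \<mu>) * u (e j) (e i) else 0)"
      unfolding sum.distrib[symmetric] by (rule sum.cong) (auto simp: algebra_simps)
    also have "(\<Sum>x<N. fourier_coeff q V (\<lambda>y. e x y - e j y) * u (e x) (e i)) =
        (\<Sum>m\<in>fundamental_cell q. fourier_coeff q V (\<lambda>y. m y - e j y) * u m (e i))"
      unfolding N_def e_def by (rule sum_cell_enum)
    also have "\<dots> = (\<Sum>m\<in>fundamental_cell q. fourier_coeff q V (\<lambda>y. m y - e j y) * lattice_char q m (e i))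
        * (\<Prod>y\<in>UNIV. z y powi e i y)"
      unfolding sum_distrib_right by (simp add: u_def bloch_wave_def mult_ac)
    also have "\<dots> = V (e i) * u (e j) (e i)"
      using fourier_inversion_shifted[OF q, of "e i" V "e j"] ij
      by (simp add: u_def bloch_wave_def N_def e_def cell_enum_in_cell)
    finally show "(F * U) $$ (i, j) = (U * M) $$ (i, j)" using L ij by simp
  qed (use dims in simp_all)
  hence "det F * det U = det U * det M" using dims by (simp flip: det_mult)
  hence "det F = det M" using detU by simp
  thus ?thesis by (simp add: F_def M_def floquet_charpoly_def N_def z_def)
qed

section \<open>Extension from the unit circle\<close>

text \<open>
  The values at \<open>0\<close> are left open: this way the total functions \<open>inverse\<close> and \<open>z \<mapsto> det \<dots>\<close>
  qualify whatever they are there.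
\<close>

definition laurent_polynomial :: "(complex \<Rightarrow> complex) \<Rightarrow> bool" where
  "laurent_polynomial f \<longleftrightarrow> (\<exists>N p. \<forall>x. x \<noteq> 0 \<longrightarrow> x ^ N * f x = poly p x)"

lemma laurent_polynomial_const: "laurent_polynomial (\<lambda>x. c)"
  unfolding laurent_polynomial_def by (rule exI[of _ 0], rule exI[of _ "[:c:]"]) simp

lemma laurent_polynomial_ident: "laurent_polynomial (\<lambda>x. x)"
  unfolding laurent_polynomial_def by (rule exI[of _ 0], rule exI[of _ "[:0, 1:]"]) simp

lemma laurent_polynomial_inverse: "laurent_polynomial inverse"
  unfolding laurent_polynomial_def by (rule exI[of _ 1], rule exI[of _ "[:1:]"]) simp

lemma laurent_polynomial_add:
  assumes "laurent_polynomial f" "laurent_polynomial g"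
  shows "laurent_polynomial (\<lambda>x. f x + g x)"
proof -
  obtain M p N r where "\<And>x. x \<noteq> 0 \<Longrightarrow> x ^ M * f x = poly p x" "\<And>x. x \<noteq> 0 \<Longrightarrow> x ^ N * g x = poly r x"
    using assms by (auto simp: laurent_polynomial_def)
  hence "x ^ (M + N) * (f x + g x) = poly (monom 1 N * p + monom 1 M * r) x" if "x \<noteq> 0" for x
    using that by (simp add: poly_monom power_add ring_distribs mult_ac)
  thus ?thesis unfolding laurent_polynomial_def by blast
qed

lemma laurent_polynomial_mult:
  assumes "laurent_polynomial f" "laurent_polynomial g"
  shows "laurent_polynomial (\<lambda>x. f x * g x)"
proof -
  obtain M p N r where "\<And>x. x \<noteq> 0 \<Longrightarrow> x ^ M * f x = poly p x" "\<And>x. x \<noteq> 0 \<Longrightarrow> x ^ N * g x = poly r x"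
    using assms by (auto simp: laurent_polynomial_def)
  hence "x ^ (M + N) * (f x * g x) = poly (p * r) x" if "x \<noteq> 0" for x
    using that by (simp add: power_add) (metis (no_types, lifting) mult.assoc mult.left_commute)
  thus ?thesis unfolding laurent_polynomial_def by blast
qed

lemma laurent_polynomial_sum:
  "(\<And>i. i \<in> A \<Longrightarrow> laurent_polynomial (f i)) \<Longrightarrow> laurent_polynomial (\<lambda>x. \<Sum>i\<in>A. f i x)"
  by (induction A rule: infinite_finite_induct)
    (auto intro!: laurent_polynomial_const laurent_polynomial_add)

lemma laurent_polynomial_prod:
  "(\<And>i. i \<in> A \<Longrightarrow> laurent_polynomial (f i)) \<Longrightarrow> laurent_polynomial (\<lambda>x. \<Prod>i\<in>A. f i x)"
  by (induction A rule: infinite_finite_induct)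
    (auto intro!: laurent_polynomial_const laurent_polynomial_mult)

lemma laurent_polynomial_det:
  assumes "\<And>i j. laurent_polynomial (\<lambda>x. g x i j)"
  shows "laurent_polynomial (\<lambda>x. det (mat N N (\<lambda>(i, j). g x i j)))"
proof -
  have "det (mat N N (\<lambda>(i, j). g x i j)) =
      (\<Sum>p\<in>{p. p permutes {0..<N}}. signof p * (\<Prod>i = 0..<N. g x i (p i)))" for x
    unfolding det_def'[OF mat_carrier]
    by (intro sum.cong refl arg_cong2[where f = "(*)"] prod.cong) (auto simp: permutes_in_image)
  thus ?thesis
    by (auto intro!: laurent_polynomial_sum laurent_polynomial_mult laurent_polynomial_prod
        laurent_polynomial_const assms)
qed

lemma infinite_unit_circle: "infinite {x :: complex. norm x = 1}"
proof
  assume fin: "finite {x :: complex. norm x = 1}"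
  have "inj_on cis {0..1}"
  proof (rule inj_onI)
    fix a b :: real assume ab: "a \<in> {0..1}" "b \<in> {0..1}" and "cis a = cis b"
    hence "cos a = cos b" by (simp add: complex_eq_iff)
    thus "a = b" using ab pi_ge_two by (intro cos_inj_pi[of a b]) auto
  qed
  moreover have "finite (cis ` {0..1})"
    using fin by (rule finite_subset[rotated]) auto
  ultimately have "finite {0..1::real}" by (simp add: finite_image_iff)
  thus False by (simp add: infinite_Icc)
qed

text \<open>
  After multiplication by a power of \<open>x\<close> the difference is a polynomial with infinitely many roots.
\<close>

lemma laurent_polynomial_eq_from_circle:
  assumes "laurent_polynomial f" "laurent_polynomial g"
    and "\<And>x. norm x = 1 \<Longrightarrow> f x = g x" and "x \<noteq> 0"
  shows "f x = g x"
proof -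
  have "laurent_polynomial (\<lambda>x. f x + (- 1) * g x)"
    by (intro laurent_polynomial_add laurent_polynomial_mult laurent_polynomial_const assms)
  then obtain N p where p: "\<And>x. x \<noteq> 0 \<Longrightarrow> x ^ N * (f x - g x) = poly p x"
    by (auto simp: laurent_polynomial_def)
  have "{x. norm x = 1} \<subseteq> {x. poly p x = 0}"
  proof
    fix y :: complex assume "y \<in> {x. norm x = 1}"
    moreover from this have "y \<noteq> 0" by auto
    ultimately show "y \<in> {x. poly p x = 0}" using p[of y] assms(3) by simp
  qed
  hence "infinite {x. poly p x = 0}" using infinite_unit_circle finite_subset by blast
  hence "p = 0" using poly_roots_finite by blast
  thus ?thesis using p[of x] \<open>x \<noteq> 0\<close> by simp
qed

lemma laurent_polynomial_det_fourier_matrix: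
  "laurent_polynomial (\<lambda>x. det (fourier_matrix q V \<mu> (z(t := x))))"
  unfolding fourier_matrix_def
proof (rule laurent_polynomial_det)
  fix i j
  let ?r = "\<lambda>l. unity_root (q l) (cell_enum q j l)"
  have "laurent_polynomial (\<lambda>x. laplace_symbol q (z(t := x)) (cell_enum q j))"
    unfolding laplace_symbol_def
  proof (rule laurent_polynomial_sum)
    fix l
    show "laurent_polynomial (\<lambda>x. ?r l * (z(t := x)) l + inverse (?r l * (z(t := x)) l))"
      by (cases "l = t") (simp_all add: laurent_polynomial_add laurent_polynomial_mult
          laurent_polynomial_const laurent_polynomial_ident laurent_polynomial_inverse)
  qed
  hence "laurent_polynomial (\<lambda>x. laplace_symbol q (z(t := x)) (cell_enum q j) + (- \<mu>))"
    by (intro laurent_polynomial_add laurent_polynomial_const)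
  thus "laurent_polynomial (\<lambda>x. fourier_coeff q V (\<lambda>y. cell_enum q i y - cell_enum q j y) +
      (if i = j then laplace_symbol q (z(t := x)) (cell_enum q j) - \<mu> else 0))"
    by (cases "i = j") (simp_all add: laurent_polynomial_add laurent_polynomial_const)
qed

lemma unit_circle_quasi_phase:
  assumes "0 < p" "norm (z :: complex) = 1"
  obtains \<theta> where "z = cis (2 * pi * \<theta> / real p)"
proof
  have "z \<noteq> 0" using assms by auto
  hence "z = cis (Arg z)" using assms by (simp add: cis_Arg sgn_div_norm)
  thus "z = cis (2 * pi * (real p * Arg z / (2 * pi)) / real p)" using assms(1) by simp
qed

text \<open>
  The three variables are released from the unit circle one after the other, the last one first.
\<close>

lemma det_fourier_matrix_eq_on_torus:
  assumes q: "\<forall>j. 0 < q j" and "s \<in> S" "t \<in> S" "r \<in> S" "s \<noteq> t" "s \<noteq> r" "t \<noteq> r"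
    and iso: "\<forall>k. (\<forall>j. j \<notin> S \<longrightarrow> k j = kstar j) \<longrightarrow>
        floquet_charpoly q V k lam1 = floquet_charpoly q Y k lam2"
    and nz: "x \<noteq> 0" "y \<noteq> 0" "w \<noteq> 0"
  shows "det (fourier_matrix q V lam1 ((quasi_phase q kstar)(s := x, t := y, r := w))) =
         det (fourier_matrix q Y lam2 ((quasi_phase q kstar)(s := x, t := y, r := w)))"
proof -
  let ?z = "\<lambda>x y w. (quasi_phase q kstar)(s := x, t := y, r := w)"
  let ?eq = "\<lambda>x y w. det (fourier_matrix q V lam1 (?z x y w)) = det (fourier_matrix q Y lam2 (?z x y w))"
  have 0: "?eq x y w" if n: "norm x = 1" "norm y = 1" "norm w = 1" for x y w
  proof -
    obtain a where a: "x = cis (2 * pi * a / real (q s))" using q n unit_circle_quasi_phase by blast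
    obtain b where b: "y = cis (2 * pi * b / real (q t))" using q n unit_circle_quasi_phase by blast
    obtain c where c: "w = cis (2 * pi * c / real (q r))" using q n unit_circle_quasi_phase by blast
    let ?k = "kstar(s := a, t := b, r := c)"
    have "quasi_phase q ?k = ?z x y w" by (auto simp: quasi_phase_def a b c)
    moreover have "floquet_charpoly q V ?k lam1 = floquet_charpoly q Y ?k lam2"
      using assms by (intro iso[rule_format]) auto
    ultimately show ?thesis by (simp add: floquet_charpoly_eq_det_fourier_matrix[OF q])
  qed
  have extend: "det (fourier_matrix q V lam1 (z(u := y))) = det (fourier_matrix q Y lam2 (z(u := y)))"
    if "\<And>y. norm y = 1 \<Longrightarrow>
      det (fourier_matrix q V lam1 (z(u := y))) = det (fourier_matrix q Y lam2 (z(u := y)))"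
      and "y \<noteq> 0" for z u y
    by (rule laurent_polynomial_eq_from_circle[OF laurent_polynomial_det_fourier_matrix
          laurent_polynomial_det_fourier_matrix that])
  have 1: "?eq x y w" if "norm x = 1" "norm y = 1" and "w \<noteq> 0" for x y w
    by (rule extend) (use 0 that in auto)
  have 2: "?eq x y w" if "norm x = 1" and "y \<noteq> 0" "w \<noteq> 0" for x y w
  proof -
    have swap: "?z x y w = (quasi_phase q kstar)(s := x, r := w, t := y)" for y
      using \<open>t \<noteq> r\<close> by (simp add: fun_upd_twist)
    show ?thesis unfolding swap by (rule extend) (use 1 that in \<open>simp_all flip: swap\<close>)
  qed
  have swap: "?z x y w = (quasi_phase q kstar)(t := y, r := w, s := x)" for x
    using \<open>s \<noteq> t\<close> \<open>s \<noteq> r\<close> by auto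
  show ?thesis unfolding swap by (rule extend) (use 2 nz in \<open>simp_all flip: swap\<close>)
qed

section \<open>Determinants of nearly diagonal matrices\<close>

text \<open>
  The product rule at \<open>0\<close> in terms of difference quotients, which makes it applicable to functions
  \<open>F i\<close> with no prescribed value at \<open>0\<close>.
\<close>

lemma prod_first_order:
  fixes F :: "'a \<Rightarrow> complex \<Rightarrow> complex"
  assumes "finite A" and nz: "\<And>i. i \<in> A \<Longrightarrow> d i \<noteq> 0"
    and F: "\<And>i. i \<in> A \<Longrightarrow> ((\<lambda>x. (F i x - d i) / x) \<longlongrightarrow> f i) (at 0)"
  shows "((\<lambda>x. ((\<Prod>i\<in>A. F i x) - (\<Prod>i\<in>A. d i)) / x) \<longlongrightarrow> (\<Prod>i\<in>A. d i) * (\<Sum>i\<in>A. f i / d i)) (at 0)"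
  using assms
proof (induction A rule: finite_induct)
  case empty
  show ?case by simp
next
  case (insert a A)
  let ?P = "\<lambda>x. \<Prod>i\<in>A. F i x" and ?D = "\<Prod>i\<in>A. d i"
  have "((\<lambda>x. d a + x * ((F a x - d a) / x)) \<longlongrightarrow> d a + 0 * f a) (at 0)"
    by (intro tendsto_intros insert.prems) auto
  hence "((\<lambda>x. d a + x * ((F a x - d a) / x)) \<longlongrightarrow> d a) (at 0)"
    by simp
  hence "((\<lambda>x. F a x) \<longlongrightarrow> d a) (at 0)"
    by (intro Lim_transform_eventually[where g = "F a"]) (auto simp: eventually_at_filter)
  hence "((\<lambda>x. F a x * ((?P x - ?D) / x) + (F a x - d a) / x * ?D) \<longlongrightarrow>
      d a * (?D * (\<Sum>i\<in>A. f i / d i)) + f a * ?D) (at 0)"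
    by (intro tendsto_intros insert.IH insert.prems) auto
  moreover have "F a x * ((?P x - ?D) / x) + (F a x - d a) / x * ?D =
      ((\<Prod>i\<in>insert a A. F i x) - (\<Prod>i\<in>insert a A. d i)) / x" for x
    using insert.hyps by (simp add: add_divide_distrib[symmetric] algebra_simps)
  moreover have "d a * (?D * (\<Sum>i\<in>A. f i / d i)) + f a * ?D =
      (\<Prod>i\<in>insert a A. d i) * (\<Sum>i\<in>insert a A. f i / d i)"
    using insert.hyps insert.prems(1) by (simp add: algebra_simps)
  ultimately show ?case by simp
qed

definition moved :: "(nat \<Rightarrow> nat) \<Rightarrow> nat set" where
  "moved p = {i. p i \<noteq> i}"

lemma moved_subset: "p permutes A \<Longrightarrow> moved p \<subseteq> A"
  by (auto simp: moved_def permutes_def)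

lemma permutes_moved: "p permutes A \<Longrightarrow> p permutes moved p"
  by (rule permutes_superset) (auto simp: moved_def)

lemma card_moved_ge_2:
  assumes "p permutes A" "finite A" "p \<noteq> id"
  shows "2 \<le> card (moved p)"
proof -
  have fin: "finite (moved p)" using assms moved_subset finite_subset by metis
  have "card (moved p) \<noteq> 0" using assms(3) fin by (auto simp: moved_def fun_eq_iff)
  moreover have "card (moved p) \<noteq> 1"
  proof
    assume "card (moved p) = 1"
    then obtain a where "moved p = {a}" by (auto simp: card_1_singleton_iff)
    hence "p permutes {a}" using permutes_moved[OF assms(1)] by simp
    thus False using assms(3) by simp
  qed
  ultimately show ?thesis by linarith
qed

lemma bij_betw_transpose_card_moved_2:
  "bij_betw (\<lambda>(i, j). Transposition.transpose i j) {(i, j). i < j \<and> j < N}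
     {p. p permutes {0..<N} \<and> card (moved p) = 2}"
proof (rule bij_betwI')
  have mv: "moved (Transposition.transpose i j) = {i, j}" if "i \<noteq> j" for i j
    using that by (auto simp: moved_def transpose_def)
  fix x assume x: "x \<in> {(i, j). i < j \<and> j < N}"
  thus "(\<lambda>(i, j). Transposition.transpose i j) x \<in> {p. p permutes {0..<N} \<and> card (moved p) = 2}"
    by (auto simp: mv intro!: permutes_swap_id)
  fix y assume y: "y \<in> {(i, j). i < j \<and> j < N}"
  show "((\<lambda>(i, j). Transposition.transpose i j) x = (\<lambda>(i, j). Transposition.transpose i j) y) = (x = y)"
  proof
    assume "(\<lambda>(i, j). Transposition.transpose i j) x = (\<lambda>(i, j). Transposition.transpose i j) y"
    hence "{fst x, snd x} = {fst y, snd y}"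
      using x y mv[of "fst x" "snd x"] mv[of "fst y" "snd y"] by (auto simp: split_def)
    thus "x = y" using x y by (auto simp: doubleton_eq_iff)
  qed simp
next
  fix p assume "p \<in> {p. p permutes {0..<N} \<and> card (moved p) = 2}"
  hence p: "p permutes {0..<N}" "card (moved p) = 2" by auto
  then obtain a b where ab: "moved p = {a, b}" "a \<noteq> b" by (auto simp: card_2_iff)
  have "p permutes {a, b}" using permutes_moved[OF p(1)] ab by simp
  moreover have "p \<noteq> id" using p(2) by (auto simp: moved_def)
  ultimately have "p = Transposition.transpose a b" by (simp add: permutes_doubleton_iff)
  moreover have "a < N" "b < N" using moved_subset[OF p(1)] ab by auto
  ultimately show "\<exists>x\<in>{(i, j). i < j \<and> j < N}. p = (\<lambda>(i, j). Transposition.transpose i j) x"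
    using ab(2) transpose_commute[of a b]
    by (intro bexI[of _ "(min a b, max a b)"]) (auto simp: min_def max_def)
qed

text \<open>
  In the Leibniz expansion the term of a permutation carries one factor \<open>x\<close> for each moved point. A
  permutation other than the identity moves at least two points, and it moves exactly two only if it
  is a transposition. The product of the diagonal is subtracted as it stands, instead of its
  expansion: in the application it cancels between the two matrices.
\<close>

lemma det_nearly_diagonal_second_order:
  fixes F :: "nat \<Rightarrow> complex \<Rightarrow> complex" and B :: "nat \<Rightarrow> nat \<Rightarrow> complex"
  assumes F: "\<And>i. i < N \<Longrightarrow> ((\<lambda>x. F i x) \<longlongrightarrow> d i) (at 0)" and nz: "\<And>i. i < N \<Longrightarrow> d i \<noteq> 0"
  shows "((\<lambda>x. (det (mat N N (\<lambda>(i, j). if i = j then F i x else x * B i j)) - (\<Prod>i<N. F i x)) / x\<^sup>2) \<longlongrightarrow>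
    - (\<Prod>i<N. d i) * (\<Sum>(i, j)\<in>{(i, j). i < j \<and> j < N}. B i j * B j i / (d i * d j))) (at 0)"
proof -
  let ?P = "{p. p permutes {0..<N}}"
  define T where "T p x = signof p * (\<Prod>i = 0..<N. if p i = i then F i x else x * B i (p i))" for p x
  define G where "G p = (if card (moved p) = 2 then signof p * ((\<Prod>i\<in>moved p. B i (p i)) * (\<Prod>i\<in>{0..<N} - moved p. d i)) else 0)" for p
  have fin: "finite ?P" by (simp add: finite_permutations)
  have id: "id \<in> ?P" by (simp add: permutes_id)
  have det: "det (mat N N (\<lambda>(i, j). if i = j then F i x else x * B i j)) = (\<Sum>p\<in>?P. T p x)" for x
    unfolding det_def'[OF mat_carrier] T_def
    by (intro sum.cong refl arg_cong2[where f = "(*)"] prod.cong) (auto simp: permutes_in_image)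
  have Tid: "T id x = (\<Prod>i<N. F i x)" for x
    by (simp add: T_def sign_id atLeast0LessThan)
  have lim: "((\<lambda>x. T p x / x\<^sup>2) \<longlongrightarrow> G p) (at 0)" if p: "p \<in> ?P - {id}" for p
  proof -
    have p': "p permutes {0..<N}" "p \<noteq> id" using p by auto
    define c where "c = card (moved p) - 2"
    have c: "card (moved p) = c + 2" using card_moved_ge_2[OF p'(1) _ p'(2)] by (simp add: c_def)
    have sub: "moved p \<subseteq> {0..<N}" by (rule moved_subset[OF p'(1)])
    have "T p x = signof p * ((\<Prod>i\<in>{0..<N} - moved p. F i x) * (\<Prod>i\<in>moved p. x * B i (p i)))" for x
      unfolding T_def by (subst prod.subset_diff[OF sub])
        (auto simp: moved_def intro!: arg_cong2[where f = "(*)"] prod.cong)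
    hence "T p x = signof p * (\<Prod>i\<in>{0..<N} - moved p. F i x) * (\<Prod>i\<in>moved p. B i (p i)) * x ^ c * x\<^sup>2" for x
      by (simp add: prod.distrib c power_add mult_ac power2_eq_square)
    hence T: "signof p * (\<Prod>i\<in>{0..<N} - moved p. F i x) * (\<Prod>i\<in>moved p. B i (p i)) * x ^ c = T p x / x\<^sup>2"
      if "x \<noteq> 0" for x using that by simp
    have "((\<lambda>x. signof p * (\<Prod>i\<in>{0..<N} - moved p. F i x) * (\<Prod>i\<in>moved p. B i (p i)) * x ^ c) \<longlongrightarrow>
        signof p * (\<Prod>i\<in>{0..<N} - moved p. d i) * (\<Prod>i\<in>moved p. B i (p i)) * 0 ^ c) (at 0)"
      by (intro tendsto_intros F) auto
    hence "((\<lambda>x. T p x / x\<^sup>2) \<longlongrightarrow>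
        signof p * (\<Prod>i\<in>{0..<N} - moved p. d i) * (\<Prod>i\<in>moved p. B i (p i)) * 0 ^ c) (at 0)"
      by (rule Lim_transform_eventually) (auto simp: eventually_at_filter T)
    also have "signof p * (\<Prod>i\<in>{0..<N} - moved p. d i) * (\<Prod>i\<in>moved p. B i (p i)) * 0 ^ c = G p"
      by (cases c) (simp_all add: G_def c)
    finally show ?thesis .
  qed
  have "((\<lambda>x. \<Sum>p\<in>?P - {id}. T p x / x\<^sup>2) \<longlongrightarrow> (\<Sum>p\<in>?P - {id}. G p)) (at 0)"
    by (intro tendsto_sum lim)
  moreover have "(\<Sum>p\<in>?P - {id}. T p x / x\<^sup>2) =
      (det (mat N N (\<lambda>(i, j). if i = j then F i x else x * B i j)) - (\<Prod>i<N. F i x)) / x\<^sup>2" for x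
    unfolding det Tid[symmetric] by (simp add: sum.remove[OF fin id] sum_divide_distrib)
  moreover have "(\<Sum>p\<in>?P - {id}. G p) =
      - (\<Prod>i<N. d i) * (\<Sum>(i, j)\<in>{(i, j). i < j \<and> j < N}. B i j * B j i / (d i * d j))"
  proof -
    have "(\<Sum>p\<in>?P - {id}. G p) = (\<Sum>p\<in>{p. p permutes {0..<N} \<and> card (moved p) = 2}. G p)"
      by (rule sum.mono_neutral_right) (use fin in \<open>auto simp: G_def moved_def\<close>)
    also have "\<dots> = (\<Sum>x\<in>{(i, j). i < j \<and> j < N}. G ((\<lambda>(i, j). Transposition.transpose i j) x))"
      by (rule sum.reindex_bij_betw[OF bij_betw_transpose_card_moved_2, symmetric])
    also have "\<dots> = (\<Sum>x\<in>{(i, j). i < j \<and> j < N}. - (\<Prod>i<N. d i) * (case x of (i, j) \<Rightarrow> B i j * B j i / (d i * d j)))"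
    proof (rule sum.cong)
      fix x assume "x \<in> {(i, j). i < j \<and> j < N}"
      then obtain i j where x: "x = (i, j)" and ij: "i < j" "j < N" by auto
      have mv: "moved (Transposition.transpose i j) = {i, j}"
        using ij by (auto simp: moved_def transpose_def)
      have "(\<Prod>i<N. d i) = (\<Prod>k\<in>{0..<N} - {i, j}. d k) * (d i * d j)"
        using prod.subset_diff[of "{i, j}" "{0..<N}" d] ij by (simp add: atLeast0LessThan)
      hence "(\<Prod>k\<in>{0..<N} - {i, j}. d k) = (\<Prod>i<N. d i) / (d i * d j)"
        using ij nz by simp
      thus "G ((\<lambda>(i, j). Transposition.transpose i j) x) = - (\<Prod>i<N. d i) * (case x of (i, j) \<Rightarrow> B i j * B j i / (d i * d j))"
        using ij by (simp add: G_def x mv sign_swap_id)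
    qed simp
    also have "\<dots> = - (\<Prod>i<N. d i) * (\<Sum>(i, j)\<in>{(i, j). i < j \<and> j < N}. B i j * B j i / (d i * d j))"
      by (simp only: sum_distrib_left)
    finally show ?thesis .
  qed
  ultimately show ?thesis by simp
qed

text \<open>
  The diagonals of the two matrices differ only by the constants \<open>a\<close> and \<open>b\<close> in the first order.
  Comparing first orders yields \<open>a = b\<close> as soon as \<open>\<Sum>1/d\<^sub>i \<noteq> 0\<close>; then the diagonals agree and only the
  off-diagonal products remain in the second order.
\<close>

lemma det_eq_imp_expansions_eq:
  fixes d c m :: "nat \<Rightarrow> complex" and A B :: "nat \<Rightarrow> nat \<Rightarrow> complex"
  assumes nz: "\<And>i. i < N \<Longrightarrow> d i \<noteq> 0"
    and eq: "\<And>x. x \<noteq> 0 \<Longrightarrow>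
      det (mat N N (\<lambda>(i, j). if i = j then d i + x * (a + c i) + x\<^sup>2 * m i else x * A i j)) =
      det (mat N N (\<lambda>(i, j). if i = j then d i + x * (b + c i) + x\<^sup>2 * m i else x * B i j))"
  shows "(a - b) * (\<Sum>i<N. 1 / d i) = 0"
    and "a = b \<Longrightarrow> (\<Sum>(i, j)\<in>{(i, j). i < j \<and> j < N}. (A i j * A j i - B i j * B j i) / (d i * d j)) = 0"
proof -
  define F where "F a i x = d i + x * (a + c i) + x\<^sup>2 * m i" for a i x
  define D where "D a A x = det (mat N N (\<lambda>(i, j). if i = j then F a i x else x * A i j))" for a A x
  let ?\<Pi> = "\<Prod>i<N. d i"
  let ?S = "\<lambda>A. \<Sum>(i, j)\<in>{(i, j). i < j \<and> j < N}. A i j * A j i / (d i * d j)"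
  have \<Pi>: "?\<Pi> \<noteq> 0" using nz by simp
  have second: "((\<lambda>x. (D a A x - (\<Prod>i<N. F a i x)) / x\<^sup>2) \<longlongrightarrow> - ?\<Pi> * ?S A) (at 0)" for a A
    unfolding D_def
  proof (rule det_nearly_diagonal_second_order[OF _ nz])
    fix i
    have "(F a i \<longlongrightarrow> d i + 0 * (a + c i) + 0\<^sup>2 * m i) (at 0)"
      unfolding F_def by (intro tendsto_intros)
    thus "(F a i \<longlongrightarrow> d i) (at 0)" by simp
  qed
  have first: "((\<lambda>x. (D a A x - ?\<Pi>) / x) \<longlongrightarrow> ?\<Pi> * (\<Sum>i<N. (a + c i) / d i)) (at 0)" for a A
  proof -
    have "((\<lambda>x. ((\<Prod>i<N. F a i x) - ?\<Pi>) / x) \<longlongrightarrow> ?\<Pi> * (\<Sum>i<N. (a + c i) / d i)) (at 0)"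
    proof (rule prod_first_order)
      fix i
      have "((\<lambda>x. (a + c i) + x * m i) \<longlongrightarrow> (a + c i) + 0 * m i) (at 0)"
        by (intro tendsto_intros)
      hence "((\<lambda>x. (F a i x - d i) / x) \<longlongrightarrow> (a + c i) + 0 * m i) (at 0)"
        by (rule Lim_transform_eventually)
          (auto simp: eventually_at_filter F_def field_simps power2_eq_square)
      thus "((\<lambda>x. (F a i x - d i) / x) \<longlongrightarrow> a + c i) (at 0)" by simp
    qed (use nz in auto)
    moreover have "((\<lambda>x. x * ((D a A x - (\<Prod>i<N. F a i x)) / x\<^sup>2)) \<longlongrightarrow> 0 * (- ?\<Pi> * ?S A)) (at 0)"
      by (intro tendsto_intros second)
    ultimately have "((\<lambda>x. ((\<Prod>i<N. F a i x) - ?\<Pi>) / x + x * ((D a A x - (\<Prod>i<N. F a i x)) / x\<^sup>2)) \<longlongrightarrow>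
        ?\<Pi> * (\<Sum>i<N. (a + c i) / d i) + 0 * (- ?\<Pi> * ?S A)) (at 0)"
      by (rule tendsto_add)
    hence "((\<lambda>x. (D a A x - ?\<Pi>) / x) \<longlongrightarrow> ?\<Pi> * (\<Sum>i<N. (a + c i) / d i) + 0 * (- ?\<Pi> * ?S A)) (at 0)"
      by (rule Lim_transform_eventually)
        (auto simp: eventually_at_filter power2_eq_square field_simps)
    thus ?thesis by simp
  qed
  have eq': "D a A x = D b B x" if "x \<noteq> 0" for x
    using eq[OF that] unfolding D_def F_def .
  have "((\<lambda>x. (D b B x - ?\<Pi>) / x) \<longlongrightarrow> ?\<Pi> * (\<Sum>i<N. (a + c i) / d i)) (at 0)"
    using first[of a A] by (rule Lim_transform_eventually) (auto simp: eventually_at_filter eq')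
  with first[of b B] have "?\<Pi> * (\<Sum>i<N. (a + c i) / d i) = ?\<Pi> * (\<Sum>i<N. (b + c i) / d i)"
    by (rule LIM_unique[rotated])
  hence "(\<Sum>i<N. (a + c i) / d i) - (\<Sum>i<N. (b + c i) / d i) = 0" using \<Pi> by simp
  thus "(a - b) * (\<Sum>i<N. 1 / d i) = 0"
    by (simp add: sum_subtractf[symmetric] sum_distrib_left diff_divide_distrib[symmetric])
  assume "a = b"
  have "((\<lambda>x. (D b B x - (\<Prod>i<N. F b i x)) / x\<^sup>2) \<longlongrightarrow> - ?\<Pi> * ?S A) (at 0)"
    using second[of a A] by (rule Lim_transform_eventually) (use eq' \<open>a = b\<close> in \<open>auto simp: eventually_at_filter\<close>)
  with second[of b B] have "- ?\<Pi> * ?S A = - ?\<Pi> * ?S B"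
    by (rule LIM_unique[rotated])
  hence "?S A - ?S B = 0" using \<Pi> by simp
  thus "(\<Sum>(i, j)\<in>{(i, j). i < j \<and> j < N}. (A i j * A j i - B i j * B j i) / (d i * d j)) = 0"
    by (simp add: sum_subtractf[symmetric] diff_divide_distrib split_def)
qed

section \<open>Rigidity of triangles\<close>

lemma quadratic_two_roots:
  fixes a b c r s u :: complex
  assumes "a \<noteq> 0" "r \<noteq> s"
    and r: "a * r\<^sup>2 + b * r + c = 0" and s: "a * s\<^sup>2 + b * s + c = 0" and u: "a * u\<^sup>2 + b * u + c = 0"
  shows "u = r \<or> u = s"
proof -
  have "(r - s) * (a * (r + s) + b) = (a * r\<^sup>2 + b * r + c) - (a * s\<^sup>2 + b * s + c)"
    by (simp add: algebra_simps power2_eq_square)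
  hence "a * (r + s) + b = 0" using assms by simp
  hence b: "b = - (a * (r + s))" by (simp add: add_eq_0_iff2)
  have "a * ((u - r) * (u - s)) = (a * u\<^sup>2 + b * u + c) - (a * r\<^sup>2 + b * r + c)"
    by (simp add: b algebra_simps power2_eq_square)
  hence "a * ((u - r) * (u - s)) = 0" using r u by simp
  thus ?thesis using assms(1) by simp
qed

text \<open>
  Complex conjugation replaces \<open>u\<close> and \<open>v\<close> by their inverses in the equation; \<open>v\<close> is then eliminated
  between the equation and its conjugate.
\<close>

lemma unit_triangle_quadratic:
  fixes u v p1 p2 p3 :: complex
  assumes "norm u = 1" "norm v = 1" and eq: "u * p1 + v * p2 + p3 = 0"
  shows "cnj p3 * p1 * u\<^sup>2 + (cnj p1 * p1 - cnj p2 * p2 + cnj p3 * p3) * u + cnj p1 * p3 = 0"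
proof -
  have uv: "u * cnj u = 1" "v * cnj v = 1"
    using assms by (simp_all flip: complex_norm_square)
  have "cnj u * cnj p1 + cnj v * cnj p2 + cnj p3 = cnj (u * p1 + v * p2 + p3)" by simp
  hence c: "cnj u * cnj p1 + cnj v * cnj p2 + cnj p3 = 0" using eq by simp
  have "(u * cnj u) * (cnj p1 * v) + (v * cnj v) * (cnj p2 * u) + cnj p3 * (u * v) =
      u * v * (cnj u * cnj p1 + cnj v * cnj p2 + cnj p3)"
    by (simp add: algebra_simps)
  hence K: "cnj p1 * v + cnj p2 * u + cnj p3 * (u * v) = 0" unfolding uv c by simp
  have "cnj p3 * p1 * u\<^sup>2 + (cnj p1 * p1 - cnj p2 * p2 + cnj p3 * p3) * u + cnj p1 * p3 =
      (cnj p3 * u + cnj p1) * (u * p1 + v * p2 + p3) - p2 * (cnj p1 * v + cnj p2 * u + cnj p3 * (u * v))"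
    by (simp add: algebra_simps power2_eq_square)
  thus ?thesis unfolding eq K by simp
qed

text \<open>
  The vector \<open>(\<gamma> - \<beta>, \<alpha> - \<gamma>, \<beta> - \<alpha>)\<close> is the cross product of \<open>(1, 1, 1)\<close> and \<open>(\<alpha>, \<beta>, \<gamma>)\<close>, so it is
  annihilated by both. Up to a common factor these are the only triples of unit numbers that
  annihilate it: the ratio of the first and the third number satisfies a quadratic equation of which
  \<open>1\<close> and \<open>\<alpha>/\<gamma>\<close> are different roots, and it determines the ratio of the second and the third.
\<close>

lemma unit_triangle_rigidity:
  fixes \<alpha> \<beta> \<gamma> x y w :: complex
  assumes n: "norm \<alpha> = 1" "norm \<beta> = 1" "norm \<gamma> = 1" "norm x = 1" "norm y = 1" "norm w = 1"
    and ne: "\<alpha> \<noteq> \<beta>" "\<alpha> \<noteq> \<gamma>" "\<beta> \<noteq> \<gamma>"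
    and eq: "x * (\<gamma> - \<beta>) + y * (\<alpha> - \<gamma>) + w * (\<beta> - \<alpha>) = 0"
  shows "(x = w \<and> y = w) \<or> (x / \<alpha> = w / \<gamma> \<and> y / \<beta> = w / \<gamma>)"
proof -
  have nz: "\<alpha> \<noteq> 0" "\<beta> \<noteq> 0" "\<gamma> \<noteq> 0" "w \<noteq> 0" using n by auto
  let ?p1 = "\<gamma> - \<beta>" and ?p2 = "\<alpha> - \<gamma>" and ?p3 = "\<beta> - \<alpha>"
  have xyw: "x / w * ?p1 + y / w * ?p2 + ?p3 = 0"
  proof -
    have "(x * ?p1 + y * ?p2 + w * ?p3) / w = 0" using eq by simp
    thus ?thesis using nz by (simp add: add_divide_distrib)
  qed
  have "x / w = 1 \<or> x / w = \<alpha> / \<gamma>"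
  proof (rule quadratic_two_roots)
    show "cnj ?p3 * ?p1 \<noteq> 0" using ne by simp
    show "1 \<noteq> \<alpha> / \<gamma>" using ne nz by simp
    show "cnj ?p3 * ?p1 * 1\<^sup>2 + (cnj ?p1 * ?p1 - cnj ?p2 * ?p2 + cnj ?p3 * ?p3) * 1 + cnj ?p1 * ?p3 = 0"
      by (rule unit_triangle_quadratic[where v = 1]) simp_all
    show "cnj ?p3 * ?p1 * (\<alpha> / \<gamma>)\<^sup>2 + (cnj ?p1 * ?p1 - cnj ?p2 * ?p2 + cnj ?p3 * ?p3) * (\<alpha> / \<gamma>) + cnj ?p1 * ?p3 = 0"
      by (rule unit_triangle_quadratic[where v = "\<beta> / \<gamma>"]) (use n nz in \<open>simp_all add: norm_divide field_simps\<close>)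
    show "cnj ?p3 * ?p1 * (x / w)\<^sup>2 + (cnj ?p1 * ?p1 - cnj ?p2 * ?p2 + cnj ?p3 * ?p3) * (x / w) + cnj ?p1 * ?p3 = 0"
      by (rule unit_triangle_quadratic[where v = "y / w"]) (use n xyw in \<open>simp_all add: norm_divide\<close>)
  qed
  thus ?thesis
  proof
    assume "x / w = 1"
    moreover from this xyw have "(y / w - 1) * ?p2 = 0" by (simp add: algebra_simps)
    ultimately show ?thesis using ne nz by simp
  next
    assume xw: "x / w = \<alpha> / \<gamma>"
    have "\<alpha> / \<gamma> * ?p1 + \<beta> / \<gamma> * ?p2 + ?p3 = 0" using nz by (simp add: field_simps)
    moreover have "(y / w - \<beta> / \<gamma>) * ?p2 = (\<alpha> / \<gamma> * ?p1 + y / w * ?p2 + ?p3) -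
        (\<alpha> / \<gamma> * ?p1 + \<beta> / \<gamma> * ?p2 + ?p3)"
      by (simp only: left_diff_distrib add_diff_cancel_left add_diff_cancel_right)
    ultimately have "(y / w - \<beta> / \<gamma>) * ?p2 = 0" using xyw unfolding xw by simp
    hence "y / w = \<beta> / \<gamma>" using ne by simp
    thus ?thesis using xw nz by (simp add: field_simps)
  qed
qed

section \<open>Asymptotics of the Fourier matrix in three directions\<close>

text \<open>
  The expansion of the symbol as the variables \<open>s\<close>, \<open>t\<close>, \<open>r\<close> tend to infinity along \<open>(v1, v2, v3)\<close>: the
  three linear terms dominate, the fixed variables contribute to the next order and the inverses to
  the one after it.
\<close>

lemma laplace_symbol_split:
  fixes z :: "'d::finite \<Rightarrow> complex"
  assumes "s \<noteq> t" "s \<noteq> r" "t \<noteq> r" "x \<noteq> 0"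
  shows "x * laplace_symbol q (z(s := v1 / x, t := v2 / x, r := v3 / x)) m =
    (unity_root (q s) (m s) * v1 + unity_root (q t) (m t) * v2 + unity_root (q r) (m r) * v3) +
    x * (\<Sum>j\<in>UNIV - {s, t, r}. unity_root (q j) (m j) * z j + inverse (unity_root (q j) (m j) * z j)) +
    x\<^sup>2 * (inverse (unity_root (q s) (m s) * v1) + inverse (unity_root (q t) (m t) * v2) +
      inverse (unity_root (q r) (m r) * v3))"
proof -
  let ?z = "z(s := v1 / x, t := v2 / x, r := v3 / x)"
  let ?h = "\<lambda>z j. unity_root (q j) (m j) * z j + inverse (unity_root (q j) (m j) * z j)"
  have "laplace_symbol q ?z m = (\<Sum>j\<in>UNIV - {s, t, r}. ?h ?z j) + (\<Sum>j\<in>{s, t, r}. ?h ?z j)"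
    unfolding laplace_symbol_def by (rule sum.subset_diff) auto
  also have "(\<Sum>j\<in>UNIV - {s, t, r}. ?h ?z j) = (\<Sum>j\<in>UNIV - {s, t, r}. ?h z j)"
    by (rule sum.cong) auto
  also have "(\<Sum>j\<in>{s, t, r}. ?h ?z j) =
      (unity_root (q s) (m s) * v1 + unity_root (q t) (m t) * v2 + unity_root (q r) (m r) * v3) / x +
      x * (inverse (unity_root (q s) (m s) * v1) + inverse (unity_root (q t) (m t) * v2) +
        inverse (unity_root (q r) (m r) * v3))"
    using assms by (simp add: divide_inverse ring_distribs mult_ac)
  finally have symbol: "laplace_symbol q ?z m = (\<Sum>j\<in>UNIV - {s, t, r}. ?h z j) +
      ((unity_root (q s) (m s) * v1 + unity_root (q t) (m t) * v2 + unity_root (q r) (m r) * v3) / x +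
      x * (inverse (unity_root (q s) (m s) * v1) + inverse (unity_root (q t) (m t) * v2) +
        inverse (unity_root (q r) (m r) * v3)))" .
  have "x * (a + (b / x + x * c)) = b + x * a + x\<^sup>2 * c" for a b c
    using \<open>x \<noteq> 0\<close> by (simp add: ring_distribs power2_eq_square)
  thus ?thesis unfolding symbol .
qed

lemma scaled_fourier_matrix:
  fixes z :: "'d::finite \<Rightarrow> complex"
  assumes "s \<noteq> t" "s \<noteq> r" "t \<noteq> r" "x \<noteq> 0"
  shows "x \<cdot>\<^sub>m fourier_matrix q V \<mu> (z(s := v1 / x, t := v2 / x, r := v3 / x)) =
    mat (cell_size q) (cell_size q) (\<lambda>(i, j). let m = cell_enum q i in if i = j then
      (unity_root (q s) (m s) * v1 + unity_root (q t) (m t) * v2 + unity_root (q r) (m r) * v3) +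
      x * ((fourier_coeff q V (\<lambda>_. 0) - \<mu>) + (\<Sum>j\<in>UNIV - {s, t, r}. unity_root (q j) (m j) * z j + inverse (unity_root (q j) (m j) * z j))) +
      x\<^sup>2 * (inverse (unity_root (q s) (m s) * v1) + inverse (unity_root (q t) (m t) * v2) +
      inverse (unity_root (q r) (m r) * v3))
      else x * fourier_coeff q V (\<lambda>y. m y - cell_enum q j y))"
proof (rule eq_matI, goal_cases)
  case (1 i j)
  show ?case
  proof (cases "i = j")
    case True
    have "(x \<cdot>\<^sub>m fourier_matrix q V \<mu> (z(s := v1 / x, t := v2 / x, r := v3 / x))) $$ (i, j) =
      x * (fourier_coeff q V (\<lambda>_. 0) - \<mu>) + x * laplace_symbol q (z(s := v1 / x, t := v2 / x, r := v3 / x)) (cell_enum q i)"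
      using 1 True by (simp add: fourier_matrix_def algebra_simps)
    thus ?thesis unfolding laplace_symbol_split[OF assms] using 1 True
      by (simp add: Let_def distrib_left)
  qed (use 1 in \<open>simp add: fourier_matrix_def Let_def\<close>)
qed (simp_all add: fourier_matrix_def)


text \<open>
  The vanishing of the Fourier coefficients with \<open>l\<^sub>s \<noteq> 0 \<noteq> l\<^sub>t\<close> is carried from \<open>V\<close> to \<open>Y\<close> by the
  second-order identity near the direction in which \<open>L\<^sub>0\<close> and \<open>L\<^sub>l\<close> vanish.
\<close>

lemma fourier_coeff_eq_0_transfer:
  fixes q :: "'d::finite \<Rightarrow> nat"
  assumes q: "\<forall>j. 0 < q j" and cop: "pairwise (\<lambda>i j. coprime (q i) (q j)) UNIV"
    and V: "\<forall>n. V n \<in> \<real>" and Y: "\<forall>n. Y n \<in> \<real>"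
    and str: "s \<noteq> t" "s \<noteq> r" "t \<noteq> r"
    and det: "\<And>x y w. x \<noteq> 0 \<Longrightarrow> y \<noteq> 0 \<Longrightarrow> w \<noteq> 0 \<Longrightarrow>
      det (fourier_matrix q V lam1 (z(s := x, t := y, r := w))) =
      det (fourier_matrix q Y lam2 (z(s := x, t := y, r := w)))"
    and V0: "\<And>l. unity_root (q s) (l s) \<noteq> 1 \<Longrightarrow> unity_root (q t) (l t) \<noteq> 1 \<Longrightarrow> fourier_coeff q V l = 0"
    and l: "l \<in> fundamental_cell q" "l s \<noteq> 0" "l t \<noteq> 0"
  shows "fourier_coeff q Y l = 0"
proof -
  define N where "N = cell_size q"
  define e where "e = cell_enum q"
  define \<alpha> where "\<alpha> i = unity_root (q s) (e i s)" for i
  define \<beta> where "\<beta> i = unity_root (q t) (e i t)" for i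
  define \<gamma> where "\<gamma> i = unity_root (q r) (e i r)" for i
  define al where "al = unity_root (q s) (l s)"
  define be where "be = unity_root (q t) (l t)"
  define ga where "ga = unity_root (q r) (l r)"
  \<comment> \<open>Coprimality enters only here: no root of unity other than \<open>1\<close> serves two directions.\<close>
  have common: "x = 1" if "x ^ q i = 1" "x ^ q j = 1" "i \<noteq> j" for x :: complex and i j
    using eq_1_if_coprime_powers_eq_1[OF that(1,2)] cop q that(3) by (simp add: pairwise_def)
  have pw: "\<alpha> i ^ q s = 1" "\<beta> i ^ q t = 1" "\<gamma> i ^ q r = 1" for i
    using q by (simp_all add: \<alpha>_def \<beta>_def \<gamma>_def unity_root_power_period)
  have pwl: "al ^ q s = 1" "be ^ q t = 1" "ga ^ q r = 1"
    using q by (simp_all add: al_def be_def ga_def unity_root_power_period)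
  have nz: "\<alpha> i \<noteq> 0" "\<beta> i \<noteq> 0" "\<gamma> i \<noteq> 0" "al \<noteq> 0" "be \<noteq> 0" "ga \<noteq> 0" for i
    by (simp_all add: \<alpha>_def \<beta>_def \<gamma>_def al_def be_def ga_def)
  have norms: "norm (\<alpha> i) = 1" "norm (\<beta> i) = 1" "norm (\<gamma> i) = 1" "norm al = 1" "norm be = 1" "norm ga = 1" for i
    by (simp_all add: \<alpha>_def \<beta>_def \<gamma>_def al_def be_def ga_def)
  have not_dvd: "\<not> int (q j) dvd l j" if "l j \<noteq> 0" for j
  proof -
    have "0 \<le> l j \<and> l j < int (q j)" using l(1) by (auto simp: fundamental_cell_def dest!: spec[of _ j])
    thus ?thesis using that zdvd_not_zless[of "l j" "int (q j)"] by linarith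
  qed
  have al1: "al \<noteq> 1" and be1: "be \<noteq> 1"
    using not_dvd l q by (simp_all add: al_def be_def unity_root_eq_1_iff)
  have ne: "al \<noteq> be" "al \<noteq> ga" "be \<noteq> ga"
    using common[of al s t] common[of al s r] common[of be t r] pwl al1 be1 str by auto
  \<comment> \<open>The indices of the frequencies that agree with \<open>0\<close>, respectively \<open>l\<close>, in the directions \<open>s\<close>, \<open>t\<close>, \<open>r\<close>.\<close>
  define J0 where "J0 = {i\<in>{..<N}. \<alpha> i = 1 \<and> \<beta> i = 1 \<and> \<gamma> i = 1}"
  define J1 where "J1 = {i\<in>{..<N}. \<alpha> i = al \<and> \<beta> i = be \<and> \<gamma> i = ga}"
  have disj: "i \<notin> J1" if "i \<in> J0" for i using that al1 by (auto simp: J0_def J1_def)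
  \<comment> \<open>The value of the linear form \<open>L\<^sub>i\<close> at the common zero of \<open>L\<^sub>0\<close> and \<open>L\<^sub>l\<close>.\<close>
  define P where "P i = \<alpha> i * (ga - be) + \<beta> i * (al - ga) + \<gamma> i * (be - al)" for i
  have P0: "P i = 0 \<longleftrightarrow> i \<in> J0 \<union> J1" if "i < N" for i
  proof
    assume "i \<in> J0 \<union> J1"
    thus "P i = 0" by (auto simp: J0_def J1_def P_def algebra_simps)
  next
    assume "P i = 0"
    hence "(\<alpha> i = \<gamma> i \<and> \<beta> i = \<gamma> i) \<or> (\<alpha> i / al = \<gamma> i / ga \<and> \<beta> i / be = \<gamma> i / ga)"
      unfolding P_def by (intro unit_triangle_rigidity norms ne)
    thus "i \<in> J0 \<union> J1"
    proof
      assume "\<alpha> i = \<gamma> i \<and> \<beta> i = \<gamma> i"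
      moreover from this have "\<gamma> i = 1" using common[of "\<gamma> i" s t] pw[of i] str by simp
      ultimately show ?thesis using that by (simp add: J0_def)
    next
      assume *: "\<alpha> i / al = \<gamma> i / ga \<and> \<beta> i / be = \<gamma> i / ga"
      have "(\<alpha> i / al) ^ q s = 1" "(\<beta> i / be) ^ q t = 1" by (simp_all add: power_divide pw pwl)
      hence "\<gamma> i / ga = 1" using * common[of "\<gamma> i / ga" s t] str by simp
      thus ?thesis using * that nz by (simp add: J1_def)
    qed
  qed
  \<comment> \<open>The line through the common zero has direction \<open>(1 - d2, d2, 0)\<close>, chosen so that the slope \<open>E\<close> is \<open>1\<close> on \<open>J0\<close> and \<open>\<i>\<close> on \<open>J1\<close>.\<close>
  define d2 where "d2 = (\<i> - al) / (be - al)"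
  define E where "E i = \<alpha> i * (1 - d2) + \<beta> i * d2" for i
  have d2: "al * (1 - d2) + be * d2 = \<i>"
  proof -
    have "al * (1 - d2) + be * d2 = al + (be - al) * d2" by (simp add: algebra_simps)
    thus ?thesis using ne by (simp add: d2_def)
  qed
  have E: "i \<in> J0 \<Longrightarrow> E i = 1" "i \<in> J1 \<Longrightarrow> E i = \<i>" for i
    using d2 by (auto simp: E_def J0_def J1_def)
  define L where "L \<delta> i = P i + \<delta> * E i" for \<delta> i
  define v1 where "v1 \<delta> = ga - be + \<delta> * (1 - d2)" for \<delta>
  define v2 where "v2 \<delta> = al - ga + \<delta> * d2" for \<delta>
  define v3 where "v3 = be - al"
  have L: "L \<delta> i = \<alpha> i * v1 \<delta> + \<beta> i * v2 \<delta> + \<gamma> i * v3" for \<delta> i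
    by (simp add: L_def P_def E_def v1_def v2_def v3_def algebra_simps)
  \<comment> \<open>The limits of \<open>\<delta>/L\<^sub>i\<close>; note that \<open>1/\<i> = -\<i>\<close>.\<close>
  define g where "g i = (if i \<in> J0 then 1 else if i \<in> J1 then - \<i> else 0)" for i
  have L_lim: "(\<lambda>\<delta>. L \<delta> i) \<midarrow>0\<rightarrow> P i" for i
  proof -
    have "(\<lambda>\<delta>. L \<delta> i) \<midarrow>0\<rightarrow> P i + 0 * E i" unfolding L_def by (intro tendsto_intros)
    thus ?thesis by simp
  qed
  have g_lim: "(\<lambda>\<delta>. \<delta> / L \<delta> i) \<midarrow>0\<rightarrow> g i" if "i < N" for i
  proof (cases "P i = 0")
    case True
    hence i: "i \<in> J0 \<union> J1" using P0 that by simp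
    hence "g i = 1 / E i" using E[of i] disj by (auto simp: g_def)
    moreover have "(\<lambda>\<delta>. \<delta> / L \<delta> i) \<midarrow>0\<rightarrow> 1 / E i"
      by (rule Lim_transform_eventually[OF tendsto_const]) (auto simp: L_def True eventually_at_filter)
    ultimately show ?thesis by simp
  next
    case False
    hence "(\<lambda>\<delta>. \<delta> / L \<delta> i) \<midarrow>0\<rightarrow> 0 / P i" by (intro tendsto_intros L_lim)
    thus ?thesis using False P0 that by (simp add: g_def)
  qed
  \<comment> \<open>On the line close to its base point, nothing vanishes that has to be divided by.\<close>
  have ev: "\<forall>\<^sub>F \<delta> in at 0. \<delta> \<noteq> 0 \<and> v1 \<delta> \<noteq> 0 \<and> v2 \<delta> \<noteq> 0 \<and> (\<forall>i\<in>{..<N}. L \<delta> i \<noteq> 0)"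
  proof (intro eventually_conj eventually_ball_finite ballI)
    show "\<forall>\<^sub>F \<delta> in at 0. \<delta> \<noteq> (0 :: complex)" by (auto simp: eventually_at_filter)
    have "v1 \<midarrow>0\<rightarrow> ga - be + 0 * (1 - d2)" unfolding v1_def by (intro tendsto_intros)
    thus "\<forall>\<^sub>F \<delta> in at 0. v1 \<delta> \<noteq> 0" by (rule tendsto_imp_eventually_ne) (use ne in simp)
    have "v2 \<midarrow>0\<rightarrow> al - ga + 0 * d2" unfolding v2_def by (intro tendsto_intros)
    thus "\<forall>\<^sub>F \<delta> in at 0. v2 \<delta> \<noteq> 0" by (rule tendsto_imp_eventually_ne) (use ne in simp)
    fix i assume "i \<in> {..<N}"
    show "\<forall>\<^sub>F \<delta> in at 0. L \<delta> i \<noteq> 0"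
    proof (cases "P i = 0")
      case True
      hence "E i \<noteq> 0" using P0 \<open>i \<in> {..<N}\<close> E[of i] by auto
      thus ?thesis by (auto simp: L_def True eventually_at_filter)
    qed (rule tendsto_imp_eventually_ne[OF L_lim])
  qed simp
  define A where "A i j = fourier_coeff q V (\<lambda>y. e i y - e j y)" for i j
  define B where "B i j = fourier_coeff q Y (\<lambda>y. e i y - e j y)" for i j
  define a where "a = fourier_coeff q V (\<lambda>_. 0) - lam1"
  define b where "b = fourier_coeff q Y (\<lambda>_. 0) - lam2"
  have expansions: "(a - b) * (\<Sum>i<N. 1 / L \<delta> i) = 0"
    "a = b \<Longrightarrow> (\<Sum>(i, j)\<in>{(i, j). i < j \<and> j < N}. (A i j * A j i - B i j * B j i) / (L \<delta> i * L \<delta> j)) = 0"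
    if \<delta>: "v1 \<delta> \<noteq> 0" "v2 \<delta> \<noteq> 0" "\<forall>i\<in>{..<N}. L \<delta> i \<noteq> 0" for \<delta>
  proof -
    define c where "c i = (\<Sum>j\<in>UNIV - {s, t, r}. unity_root (q j) (e i j) * z j + inverse (unity_root (q j) (e i j) * z j))" for i
    define m where "m i = inverse (\<alpha> i * v1 \<delta>) + inverse (\<beta> i * v2 \<delta>) + inverse (\<gamma> i * v3)" for i
    have "det (mat N N (\<lambda>(i, j). if i = j then L \<delta> i + x * (a + c i) + x\<^sup>2 * m i else x * A i j)) =
      det (mat N N (\<lambda>(i, j). if i = j then L \<delta> i + x * (b + c i) + x\<^sup>2 * m i else x * B i j))"
      if "x \<noteq> 0" for x
    proof -
      let ?z = "z(s := v1 \<delta> / x, t := v2 \<delta> / x, r := v3 / x)"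
      have "mat N N (\<lambda>(i, j). if i = j then L \<delta> i + x * (a + c i) + x\<^sup>2 * m i else x * A i j) =
          x \<cdot>\<^sub>m fourier_matrix q V lam1 ?z"
        unfolding scaled_fourier_matrix[OF str that] L N_def a_def c_def m_def A_def \<alpha>_def \<beta>_def \<gamma>_def e_def Let_def ..
      moreover have "mat N N (\<lambda>(i, j). if i = j then L \<delta> i + x * (b + c i) + x\<^sup>2 * m i else x * B i j) =
          x \<cdot>\<^sub>m fourier_matrix q Y lam2 ?z"
        unfolding scaled_fourier_matrix[OF str that] L N_def b_def c_def m_def B_def \<alpha>_def \<beta>_def \<gamma>_def e_def Let_def ..
      moreover have "det (fourier_matrix q V lam1 ?z) = det (fourier_matrix q Y lam2 ?z)"
        using \<delta> that ne by (intro det) (simp_all add: v3_def)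
      ultimately show ?thesis by (simp add: fourier_matrix_def)
    qed
    from det_eq_imp_expansions_eq[of N "L \<delta>", OF _ this] \<delta>
    show "(a - b) * (\<Sum>i<N. 1 / L \<delta> i) = 0"
      "a = b \<Longrightarrow> (\<Sum>(i, j)\<in>{(i, j). i < j \<and> j < N}. (A i j * A j i - B i j * B j i) / (L \<delta> i * L \<delta> j)) = 0"
      by auto
  qed
  have zero_in: "(\<lambda>_. 0) \<in> fundamental_cell q" using q by (simp add: fundamental_cell_def)
  have cell: "fundamental_cell q = e ` {..<N}"
    using bij_betw_imp_surj_on[OF bij_betw_cell_enum[of q]] by (simp add: N_def e_def)
  obtain i0 where i0: "i0 < N" "e i0 = (\<lambda>_. 0)" using zero_in unfolding cell by (auto dest: sym)
  obtain j0 where j0: "j0 < N" "e j0 = l" using l(1) unfolding cell by auto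
  have i0J: "i0 \<in> J0" using i0 by (simp add: J0_def \<alpha>_def \<beta>_def \<gamma>_def)
  have j0J: "j0 \<in> J1" using j0 by (simp add: J1_def \<alpha>_def \<beta>_def \<gamma>_def al_def be_def ga_def)
  \<comment> \<open>The first-order identity, multiplied by \<open>\<delta>\<close>. In the limit the second factor has positive real part, because \<open>J0\<close> is not empty.\<close>
  have "a = b"
  proof -
    have "(\<lambda>\<delta>. (a - b) * (\<Sum>i<N. \<delta> / L \<delta> i)) \<midarrow>0\<rightarrow> (a - b) * (\<Sum>i<N. g i)"
      by (intro tendsto_intros g_lim) simp
    moreover have "(\<lambda>\<delta>. (a - b) * (\<Sum>i<N. \<delta> / L \<delta> i)) \<midarrow>0\<rightarrow> 0"
    proof (rule Lim_transform_eventually[OF tendsto_const])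
      show "\<forall>\<^sub>F \<delta> in at 0. 0 = (a - b) * (\<Sum>i<N. \<delta> / L \<delta> i)"
        using ev
      proof eventually_elim
        case (elim \<delta>)
        have "(a - b) * (\<Sum>i<N. \<delta> / L \<delta> i) = \<delta> * ((a - b) * (\<Sum>i<N. 1 / L \<delta> i))"
          by (simp add: sum_distrib_left mult_ac)
        thus ?case using expansions(1)[of \<delta>] elim by simp
      qed
    qed
    ultimately have "(a - b) * (\<Sum>i<N. g i) = 0" by (rule LIM_unique)
    moreover have "Re (\<Sum>i<N. g i) > 0"
    proof -
      have "0 < Re (g i0)" using i0J by (simp add: g_def)
      also have "\<dots> \<le> (\<Sum>i<N. Re (g i))"
        using i0 by (intro member_le_sum) (auto simp: g_def)
      finally show ?thesis by simp
    qed
    hence "(\<Sum>i<N. g i) \<noteq> 0" by (metis less_irrefl zero_complex.sel(1))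
    ultimately show "a = b" by simp
  qed
  let ?I = "{(i, j). i < j \<and> j < N}"
  \<comment> \<open>The second-order identity, multiplied by \<open>\<delta>\<^sup>2\<close>. Its imaginary part retains the mixed pairs only.\<close>
  define \<omega> where "\<omega> i j = (cmod (A i j))\<^sup>2 - (cmod (B i j))\<^sup>2" for i j
  have \<omega>: "A i j * A j i - B i j * B j i = of_real (\<omega> i j)" for i j
    unfolding A_def B_def \<omega>_def of_real_diff
    by (simp only: fourier_coeff_mult_minus_real[OF V] fourier_coeff_mult_minus_real[OF Y])
  have fin: "finite ?I" by (rule finite_subset[of _ "{..<N} \<times> {..<N}"]) auto
  have "(\<lambda>\<delta>. \<Sum>(i, j)\<in>?I. of_real (\<omega> i j) * (\<delta> / L \<delta> i) * (\<delta> / L \<delta> j)) \<midarrow>0\<rightarrow>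
      (\<Sum>(i, j)\<in>?I. of_real (\<omega> i j) * g i * g j)"
    unfolding split_def by (intro tendsto_intros g_lim) auto
  moreover have "(\<lambda>\<delta>. \<Sum>(i, j)\<in>?I. of_real (\<omega> i j) * (\<delta> / L \<delta> i) * (\<delta> / L \<delta> j)) \<midarrow>0\<rightarrow> 0"
  proof (rule Lim_transform_eventually[OF tendsto_const])
    show "\<forall>\<^sub>F \<delta> in at 0. 0 = (\<Sum>(i, j)\<in>?I. of_real (\<omega> i j) * (\<delta> / L \<delta> i) * (\<delta> / L \<delta> j))"
      using ev
    proof eventually_elim
      case (elim \<delta>)
      have "(\<Sum>(i, j)\<in>?I. of_real (\<omega> i j) * (\<delta> / L \<delta> i) * (\<delta> / L \<delta> j)) =
          \<delta>\<^sup>2 * (\<Sum>(i, j)\<in>?I. of_real (\<omega> i j) / (L \<delta> i * L \<delta> j))"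
        by (simp add: sum_distrib_left split_def power2_eq_square mult_ac)
      thus ?case using expansions(2)[of \<delta>] elim \<open>a = b\<close> by (simp add: \<omega>)
    qed
  qed
  ultimately have "(\<Sum>(i, j)\<in>?I. of_real (\<omega> i j) * g i * g j) = 0" by (rule LIM_unique)
  hence "Im (\<Sum>(i, j)\<in>?I. of_real (\<omega> i j) * g i * g j) = 0" by simp
  hence sum0: "(\<Sum>(i, j)\<in>?I. \<omega> i j * Im (g i * g j)) = 0"
    by (simp add: split_def mult.assoc)
  have A0: "A i j = 0" if "i \<in> J0 \<and> j \<in> J1 \<or> i \<in> J1 \<and> j \<in> J0" for i j
    unfolding A_def
  proof (rule V0)
    show "unity_root (q s) (e i s - e j s) \<noteq> 1"
      using that al1 nz(4) by (auto simp: unity_root_diff J0_def J1_def \<alpha>_def)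
    show "unity_root (q t) (e i t - e j t) \<noteq> 1"
      using that be1 nz(5) by (auto simp: unity_root_diff J0_def J1_def \<beta>_def)
  qed
  have Im_g: "Im (g i * g j) = (if i \<in> J0 \<and> j \<in> J1 \<or> i \<in> J1 \<and> j \<in> J0 then - 1 else 0)" for i j
    using disj by (auto simp: g_def)
  have nonneg: "0 \<le> \<omega> i j * Im (g i * g j)" for i j
    unfolding Im_g \<omega>_def using A0[of i j] by simp
  have each: "\<omega> i j * Im (g i * g j) = 0" if "i < j" "j < N" for i j
  proof -
    have "\<forall>x\<in>?I. (case x of (i, j) \<Rightarrow> \<omega> i j * Im (g i * g j)) = 0"
      using sum0 nonneg by (subst (asm) sum_nonneg_eq_0_iff[OF fin]) auto
    thus ?thesis using that by auto
  qed
  have B0: "B i j = 0" if "i < j" "j < N" "i \<in> J0 \<and> j \<in> J1 \<or> i \<in> J1 \<and> j \<in> J0" for i j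
    using each[OF that(1,2)] A0[OF that(3)] that(3) unfolding Im_g \<omega>_def by simp
  \<comment> \<open>Sums run over \<open>i < j\<close>, and the enumeration of the cell is arbitrary, so both orders can occur.\<close>
  have "i0 \<noteq> j0" using disj i0J j0J by auto
  then consider "i0 < j0" | "j0 < i0" by linarith
  thus ?thesis
  proof cases
    case 1
    hence "fourier_coeff q Y (\<lambda>y. - l y) = 0" using B0[of i0 j0] i0 j0 i0J j0J by (simp add: B_def)
    thus ?thesis by (simp add: fourier_coeff_minus_real[OF Y])
  next
    case 2
    thus ?thesis using B0[of j0 i0] i0 j0 i0J j0J by (simp add: B_def)
  qed
qed

theorem theorem3p2:
  fixes q :: "'d::{finite,linorder} \<Rightarrow> nat"
    and V Y :: "('d \<Rightarrow> int) \<Rightarrow> complex"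
    and S :: "'d set"
    and lam1 lam2 :: complex
  assumes "\<forall>j. 0 < q j"
    and "pairwise (\<lambda>i j. coprime (q i) (q j)) UNIV"
    and "lattice_periodic q V" and "\<forall>n. V n \<in> \<real>"
    and "lattice_periodic q Y" and "\<forall>n. Y n \<in> \<real>"
    and "3 \<le> card S"
    and "gen_partial_fermi_isospectral q S lam1 lam2 V Y"
  shows "\<forall>s\<in>S. \<forall>t\<in>S. s < t \<longrightarrow> separable s t V \<longrightarrow> separable s t Y"
proof (intro ballI impI)
  fix s t assume st: "s \<in> S" "t \<in> S" "s < t" and sep: "separable s t V"
  have "\<not> S \<subseteq> {s, t}"
    using card_mono[of "{s, t}" S] assms(7) st(3) by (auto simp: card_insert_if)
  then obtain r where r: "r \<in> S" "r \<noteq> s" "r \<noteq> t" by auto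
  obtain kstar where kstar: "\<forall>k. (\<forall>j. j \<notin> S \<longrightarrow> k j = kstar j) \<longrightarrow>
      floquet_charpoly q V k lam1 = floquet_charpoly q Y k lam2"
    using assms(8) unfolding gen_partial_fermi_isospectral_def by blast
  show "separable s t Y"
  proof (rule separable_if_fourier_coeff_eq_0[OF assms(1,5)])
    fix l assume l: "l \<in> fundamental_cell q" "l s \<noteq> 0" "l t \<noteq> 0"
    show "fourier_coeff q Y l = 0"
    proof (rule fourier_coeff_eq_0_transfer[OF assms(1,2,4,6)])
      show "s \<noteq> t" "s \<noteq> r" "t \<noteq> r" using st r by auto
      fix x y w :: complex assume "x \<noteq> 0" "y \<noteq> 0" "w \<noteq> 0"
      thus "det (fourier_matrix q V lam1 ((quasi_phase q kstar)(s := x, t := y, r := w))) =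
          det (fourier_matrix q Y lam2 ((quasi_phase q kstar)(s := x, t := y, r := w)))"
        using st r by (intro det_fourier_matrix_eq_on_torus[OF assms(1) _ _ _ _ _ _ kstar]) auto
    next
      fix l assume "unity_root (q s) (l s) \<noteq> 1" "unity_root (q t) (l t) \<noteq> 1"
      thus "fourier_coeff q V l = 0" by (rule separable_imp_fourier_coeff_eq_0[OF assms(1) sep])
    qed (use l in auto)
  qed
qed

end
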